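(* Let $p\in\mathbb{N}$ and let $J$ be the periodic Jacobi operator on $\ell^2(\mathbb{Z})$ with real $p$-periodic coefficient sequences $\{a_i\}_{i\in\mathbb{Z}}$, $\{b_i\}_{i\in\mathbb{Z}}$, $\{c_i\}_{i\in\mathbb{Z}}$. If there is a constant $k$ with $b_i-c_i=k$ for every $i=0,1,\ldots,p-1$, then $\Lambda_{r}(J)$ is path-connected, where $$r=3\sqrt{(p-1)\left(\omega_{a_0}^2+2\omega_{b_0}^2\right)}.$$
   Context: For real sequences $\{a_i\},\{b_i\},\{c_i\}$ indexed by $\mathbb{Z}$ with $a_{i+p}=a_i$, $b_{i+p}=b_i$, $c_{i+p}=c_i$ for all $i$, the periodic Jacobi operator $J$ is the bounded (in general non-normal) linear operator on the complex Hilbert space $\ell^2(\mathbb{Z})$ given by the tridiagonal matrix with $$(Ju)_n=c_{n-1}u_{n-1}+a_nu_n+b_nu_{n+1},\qquad n\in\mathbb{Z}.$$ For a bounded operator $A$ on a complex Hilbert space with spectrum $\sigma(A)$ and $\epsilon>0$, the $\epsilon$-pseudospectrum is $$\Lambda_\epsilon(A)=\sigma(A)\cup\{z\in\mathbb{C}:\ z\notin\sigma(A),\ \|(zI-A)^{-1}\|\ge \epsilon^{-1}\},$$ and $\Lambda_0(A)=\sigma(A)$. Notation: $\omega_{a_0}=\max\{|a_i-a_0|: i=0,1,2,\ldots\}$ and $\omega_{b_0}=\max\{|b_i-b_0|: i=0,1,2,\ldots\}$. *)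

theory Defs
  imports "HOL-Analysis.Analysis"
begin

section \<open>The Hilbert space of square-summable bi-infinite complex sequences\<close>

definition square_summable :: "(int \<Rightarrow> complex) \<Rightarrow> bool"
  where "square_summable u \<longleftrightarrow> (\<lambda>n. (cmod (u n))\<^sup>2) summable_on UNIV"

lemma square_summable_zero: "square_summable (\<lambda>_. 0)"
  by (simp add: square_summable_def)

lemma square_summable_scale:
  assumes "square_summable u"
  shows "square_summable (\<lambda>n. c * u n)"
  using summable_on_cmult_right[OF assms[unfolded square_summable_def], of "(cmod c)\<^sup>2"]
  by (simp add: square_summable_def norm_mult power_mult_distrib)

lemma square_summable_add:
  assumes "square_summable u" "square_summable v"
  shows "square_summable (\<lambda>n. u n + v n)"
proof -
  have "(\<lambda>n. 2 * ((cmod (u n))\<^sup>2 + (cmod (v n))\<^sup>2)) summable_on UNIV"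
    using assms unfolding square_summable_def
    by (intro summable_on_cmult_right summable_on_add)
  moreover have "(cmod (u n + v n))\<^sup>2 \<le> 2 * ((cmod (u n))\<^sup>2 + (cmod (v n))\<^sup>2)" for n
  proof -
    have "(cmod (u n + v n))\<^sup>2 \<le> (cmod (u n) + cmod (v n))\<^sup>2"
      by (intro power_mono norm_triangle_ineq) simp
    also have "\<dots> \<le> 2 * ((cmod (u n))\<^sup>2 + (cmod (v n))\<^sup>2)"
      using sum_squares_bound[of "cmod (u n)" "cmod (v n)"] by (simp add: power2_sum)
    finally show ?thesis .
  qed
  ultimately show ?thesis
    unfolding square_summable_def by (rule summable_on_comparison_test) auto
qed

lemma square_summable_shift:
  assumes "square_summable u"
  shows "square_summable (\<lambda>n. u (n + k))"
proof -
  have "bij (\<lambda>n::int. n + k)"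
    by (intro bij_betw_byWitness[where f' = "\<lambda>n. n - k"]) auto
  from summable_on_reindex_bij_betw[OF this, of "\<lambda>n. (cmod (u n))\<^sup>2"] assms
  show ?thesis by (simp add: square_summable_def)
qed

lemma square_summable_bounded_mult:
  assumes "square_summable u" "\<And>n. cmod (m n) \<le> M"
  shows "square_summable (\<lambda>n. m n * u n)"
proof -
  have "(\<lambda>n. M\<^sup>2 * (cmod (u n))\<^sup>2) summable_on UNIV"
    using assms(1) unfolding square_summable_def by (intro summable_on_cmult_right)
  moreover have "(cmod (m n * u n))\<^sup>2 \<le> M\<^sup>2 * (cmod (u n))\<^sup>2" for n
    using assms(2) by (simp add: norm_mult power_mult_distrib mult_right_mono power_mono)
  ultimately show ?thesis
    unfolding square_summable_def by (rule summable_on_comparison_test) auto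
qed

lemma square_summable_inner:
  assumes "square_summable u" "square_summable v"
  shows "(\<lambda>n. inner (u n) (v n)) summable_on UNIV"
proof -
  have "(\<lambda>n. (cmod (u n))\<^sup>2 + (cmod (v n))\<^sup>2) summable_on UNIV"
    using assms unfolding square_summable_def by (rule summable_on_add)
  moreover have "norm (inner (u n) (v n)) \<le> (cmod (u n))\<^sup>2 + (cmod (v n))\<^sup>2" for n
  proof -
    have "norm (inner (u n) (v n)) \<le> cmod (u n) * cmod (v n)"
      by (simp add: Cauchy_Schwarz_ineq2)
    moreover have "2 * cmod (u n) * cmod (v n) \<le> (cmod (u n))\<^sup>2 + (cmod (v n))\<^sup>2"
      by (rule sum_squares_bound)
    moreover have "0 \<le> cmod (u n) * cmod (v n)" by simp
    ultimately show ?thesis by linarith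
  qed
  ultimately have "(\<lambda>n. norm (inner (u n) (v n))) summable_on UNIV"
    by (rule summable_on_comparison_test) auto
  then show ?thesis by (rule abs_summable_summable)
qed

typedef ell2 = "{u :: int \<Rightarrow> complex. square_summable u}"
  morphisms coord Abs_ell2
  using square_summable_zero by auto

setup_lifting type_definition_ell2

lemma square_summable_coord: "square_summable (coord u)"
  using coord by auto

lemma ell2_eqI: "(\<And>n. coord u n = coord v n) \<Longrightarrow> u = v"
  by (metis coord_inject ext)

instantiation ell2 :: real_vector
begin

lift_definition zero_ell2 :: ell2 is "\<lambda>_. 0"
  by (rule square_summable_zero)

lift_definition plus_ell2 :: "ell2 \<Rightarrow> ell2 \<Rightarrow> ell2" is "\<lambda>u v n. u n + v n"
  by (rule square_summable_add)

lift_definition uminus_ell2 :: "ell2 \<Rightarrow> ell2" is "\<lambda>u n. - u n"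
  by (simp add: square_summable_def)

lift_definition minus_ell2 :: "ell2 \<Rightarrow> ell2 \<Rightarrow> ell2" is "\<lambda>u v n. u n - v n"
  using square_summable_add[OF _ square_summable_scale[of _ "-1"]] by simp

lift_definition scaleR_ell2 :: "real \<Rightarrow> ell2 \<Rightarrow> ell2" is "\<lambda>r u n. r *\<^sub>R u n"
  by (simp add: scaleR_conv_of_real square_summable_scale)

instance
proof
  fix u v w :: ell2 and r s :: real
  show "u + v + w = u + (v + w)" by transfer (simp add: add.assoc)
  show "u + v = v + u" by transfer (simp add: add.commute)
  show "0 + u = u" by transfer simp
  show "- u + u = 0" by transfer simp
  show "u - v = u + - v" by transfer simp
  show "r *\<^sub>R (u + v) = r *\<^sub>R u + r *\<^sub>R v" by transfer (simp add: scaleR_add_right)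
  show "(r + s) *\<^sub>R u = r *\<^sub>R u + s *\<^sub>R u" by transfer (simp add: scaleR_add_left)
  show "r *\<^sub>R s *\<^sub>R u = (r * s) *\<^sub>R u" by transfer simp
  show "1 *\<^sub>R u = u" by transfer simp
qed

end

text \<open>
  The inner product below is the real part of the sesquilinear one: \<^const>\<open>inner\<close> on the complex
  numbers is $\mathrm{Re}(z\,\overline{w})$.  It induces the usual
  norm $\|u\| = (\sum_n |u_n|^2)^{1/2}$.
\<close>

instantiation ell2 :: real_inner
begin

lift_definition inner_ell2 :: "ell2 \<Rightarrow> ell2 \<Rightarrow> real"
  is "\<lambda>u v. \<Sum>\<^sub>\<infinity>n. inner (u n) (v n)" .

definition norm_ell2 :: "ell2 \<Rightarrow> real"
  where "norm_ell2 u = sqrt (inner u u)"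

definition dist_ell2 :: "ell2 \<Rightarrow> ell2 \<Rightarrow> real"
  where "dist_ell2 u v = norm (u - v)"

definition sgn_ell2 :: "ell2 \<Rightarrow> ell2"
  where "sgn_ell2 u = u /\<^sub>R norm u"

definition uniformity_ell2 :: "(ell2 \<times> ell2) filter"
  where "uniformity_ell2 = (INF e\<in>{0<..}. principal {(u, v). dist u v < e})"

definition open_ell2 :: "ell2 set \<Rightarrow> bool"
  where "open_ell2 U \<longleftrightarrow> (\<forall>u\<in>U. \<forall>\<^sub>F (u', v) in uniformity. u' = u \<longrightarrow> v \<in> U)"

instance
proof
  fix u v w :: ell2 and r :: real
  show "dist u v = norm (u - v)" by (rule dist_ell2_def)
  show "sgn u = u /\<^sub>R norm u" by (rule sgn_ell2_def)
  show "uniformity = (INF e\<in>{0<..}. principal {(u::ell2, v). dist u v < e})"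
    by (rule uniformity_ell2_def)
  show "open U \<longleftrightarrow> (\<forall>u\<in>U. \<forall>\<^sub>F (u', v) in uniformity. u' = u \<longrightarrow> v \<in> U)" for U :: "ell2 set"
    by (rule open_ell2_def)
  show "inner u v = inner v u" by transfer (simp add: inner_commute)
  show "inner (u + v) w = inner u w + inner v w"
    by transfer (simp add: inner_add_left infsum_add square_summable_inner)
  show "inner (r *\<^sub>R u) v = r * inner u v"
    by transfer (simp add: infsum_cmult_right')
  show "0 \<le> inner u u"
    by transfer (simp add: infsum_nonneg)
  show "inner u u = 0 \<longleftrightarrow> u = 0"
  proof
    assume "inner u u = 0"
    then have "coord u n = 0" for n
      using nonneg_infsum_le_0D[of "\<lambda>n. inner (coord u n) (coord u n)" UNIV n]
        square_summable_inner[OF square_summable_coord square_summable_coord, of u u]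
      by (simp add: inner_ell2.rep_eq)
    then show "u = 0" by (intro ell2_eqI) (simp add: zero_ell2.rep_eq)
  qed (simp add: inner_ell2.rep_eq zero_ell2.rep_eq)
  show "norm u = sqrt (inner u u)" by (rule norm_ell2_def)
qed

end

lemma norm_ell2_power2: "(norm u)\<^sup>2 = (\<Sum>\<^sub>\<infinity>n. (cmod (coord u n))\<^sup>2)"
  by (simp add: power2_norm_eq_inner inner_ell2.rep_eq)

lemma ell2_sum_le_norm:
  assumes "finite F"
  shows "(\<Sum>n\<in>F. (cmod (coord u n))\<^sup>2) \<le> (norm u)\<^sup>2"
  unfolding norm_ell2_power2
  using square_summable_coord[of u, unfolded square_summable_def] assms
  by (intro finite_sum_le_infsum) auto

lemma ell2_coord_le_norm: "cmod (coord u n) \<le> norm u"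
  using ell2_sum_le_norm[of "{n}" u] by (simp add: abs_le_square_iff[symmetric])

instance ell2 :: complete_space
proof
  fix X :: "nat \<Rightarrow> ell2"
  assume X: "Cauchy X"
  have "Cauchy (\<lambda>i. coord (X i) n)" for n
  proof (rule metric_CauchyI)
    fix e :: real assume "0 < e"
    then obtain M where M: "\<And>i j. i \<ge> M \<Longrightarrow> j \<ge> M \<Longrightarrow> dist (X i) (X j) < e"
      using metric_CauchyD[OF X] by blast
    have "dist (coord (X i) n) (coord (X j) n) \<le> dist (X i) (X j)" for i j
      using ell2_coord_le_norm[of "X i - X j" n] by (simp add: dist_norm minus_ell2.rep_eq)
    with M show "\<exists>M. \<forall>i\<ge>M. \<forall>j\<ge>M. dist (coord (X i) n) (coord (X j) n) < e"
      by (meson le_less_trans)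
  qed
  then have "\<exists>l. (\<lambda>i. coord (X i) n) \<longlonglongrightarrow> l" for n
    by (simp add: Cauchy_convergent_iff convergent_def)
  then obtain f where f: "\<And>n. (\<lambda>i. coord (X i) n) \<longlonglongrightarrow> f n" by metis
  have bound: "(\<Sum>n\<in>F. (cmod (coord (X i) n - f n))\<^sup>2) \<le> e\<^sup>2"
    if "finite F" "0 < e" "\<And>j. j \<ge> M \<Longrightarrow> dist (X i) (X j) < e" for F i M and e :: real
  proof (rule tendsto_upperbound)
    show "(\<lambda>j. \<Sum>n\<in>F. (cmod (coord (X i) n - coord (X j) n))\<^sup>2)
      \<longlonglongrightarrow> (\<Sum>n\<in>F. (cmod (coord (X i) n - f n))\<^sup>2)"
      by (intro tendsto_intros f)
    show "\<forall>\<^sub>F j in sequentially. (\<Sum>n\<in>F. (cmod (coord (X i) n - coord (X j) n))\<^sup>2) \<le> e\<^sup>2"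
      using eventually_ge_at_top[of M]
    proof eventually_elim
      case (elim j)
      have "(\<Sum>n\<in>F. (cmod (coord (X i) n - coord (X j) n))\<^sup>2) \<le> (norm (X i - X j))\<^sup>2"
        using ell2_sum_le_norm[OF that(1), of "X i - X j"] by (simp add: minus_ell2.rep_eq)
      also have "\<dots> \<le> e\<^sup>2"
        using that(3)[OF elim] by (intro power_mono) (simp_all add: dist_norm)
      finally show ?case .
    qed
  qed simp
  have ss_diff: "square_summable (\<lambda>n. coord (X i) n - f n)"
    if "0 < e" "\<And>j. j \<ge> M \<Longrightarrow> dist (X i) (X j) < e" for i M and e :: real
    unfolding square_summable_def
    by (rule nonneg_bdd_above_summable_on) (auto intro!: bdd_aboveI2 bound[OF _ that])
  obtain M where M: "\<And>i j. i \<ge> M \<Longrightarrow> j \<ge> M \<Longrightarrow> dist (X i) (X j) < 1"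
    using metric_CauchyD[OF X, of 1] by auto
  have "square_summable (\<lambda>n. coord (X M) n + (- 1) * (coord (X M) n - f n))"
    by (intro square_summable_add square_summable_scale square_summable_coord ss_diff[of 1 M])
      (auto intro: M)
  then have f_ss: "square_summable f" by simp
  define l where "l = Abs_ell2 f"
  have coord_l: "coord l = f" using f_ss by (simp add: l_def Abs_ell2_inverse)
  have "X \<longlonglongrightarrow> l"
  proof (rule metric_LIMSEQ_I)
    fix e :: real assume "0 < e"
    then obtain M where M: "\<And>i j. i \<ge> M \<Longrightarrow> j \<ge> M \<Longrightarrow> dist (X i) (X j) < e / 2"
      using metric_CauchyD[OF X, of "e / 2"] by auto
    have "dist (X i) l < e" if "i \<ge> M" for i
    proof -
      have "(norm (X i - l))\<^sup>2 = (\<Sum>\<^sub>\<infinity>n. (cmod (coord (X i) n - f n))\<^sup>2)"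
        by (simp add: norm_ell2_power2 minus_ell2.rep_eq coord_l)
      also have "\<dots> \<le> (e / 2)\<^sup>2"
        using ss_diff[of "e / 2" M i] M[OF that] \<open>0 < e\<close>
        by (intro infsum_le_finite_sums bound[where M = M]) (auto simp: square_summable_def)
      finally have "norm (X i - l) \<le> e / 2"
        using \<open>0 < e\<close> by (simp add: abs_le_square_iff[symmetric])
      then show ?thesis using \<open>0 < e\<close> by (simp add: dist_norm)
    qed
    then show "\<exists>M. \<forall>i\<ge>M. dist (X i) l < e" by blast
  qed
  then show "convergent X" by (rule convergentI)
qed

instance ell2 :: banach ..

lift_definition scaleC :: "complex \<Rightarrow> ell2 \<Rightarrow> ell2" (infixr \<open>*\<^sub>C\<close> 75)
  is "\<lambda>c u n. c * u n"
  by (rule square_summable_scale)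


section \<open>Bounded operators, spectrum and pseudospectrum\<close>

definition bounded_clinear :: "(ell2 \<Rightarrow> ell2) \<Rightarrow> bool"
  where "bounded_clinear A \<longleftrightarrow> bounded_linear A \<and> (\<forall>c u. A (c *\<^sub>C u) = c *\<^sub>C A u)"

definition spectrum :: "(ell2 \<Rightarrow> ell2) \<Rightarrow> complex set"
  where "spectrum A = {z. \<not> (\<exists>B. bounded_clinear B \<and>
    (\<forall>u. B (z *\<^sub>C u - A u) = u) \<and> (\<forall>u. z *\<^sub>C B u - A (B u) = u))}"

definition resolvent :: "(ell2 \<Rightarrow> ell2) \<Rightarrow> complex \<Rightarrow> ell2 \<Rightarrow> ell2"
  where "resolvent A z = inv (\<lambda>u. z *\<^sub>C u - A u)"

text \<open>The conjunct \<^prop>\<open>0 < \<epsilon>\<close> makes the \<open>0\<close>-pseudospectrum equal to the spectrum;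
  without it \<^term>\<open>inverse 0 = (0::real)\<close> would put the whole resolvent set into it.\<close>

definition pseudospectrum :: "real \<Rightarrow> (ell2 \<Rightarrow> ell2) \<Rightarrow> complex set"
  where "pseudospectrum \<epsilon> A =
    spectrum A \<union> {z. z \<notin> spectrum A \<and> 0 < \<epsilon> \<and> onorm (resolvent A z) \<ge> inverse \<epsilon>}"

lemma pseudospectrum_0: "pseudospectrum 0 A = spectrum A"
  by (simp add: pseudospectrum_def)


section \<open>Periodic Jacobi operators\<close>

definition periodic :: "nat \<Rightarrow> (int \<Rightarrow> real) \<Rightarrow> bool"
  where "periodic p a \<longleftrightarrow> (\<forall>i. a (i + int p) = a i)"

text \<open>Meaningful when the right-hand side is square-summable for every \<open>u\<close>; this is the case for
  periodic coefficients, see \<open>coord_jacobi\<close>, and the operator is then bounded, see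
  \<open>bounded_clinear_jacobi\<close>.\<close>

definition jacobi :: "(int \<Rightarrow> real) \<Rightarrow> (int \<Rightarrow> real) \<Rightarrow> (int \<Rightarrow> real) \<Rightarrow> ell2 \<Rightarrow> ell2"
  where "jacobi a b c u = Abs_ell2 (\<lambda>n. complex_of_real (c (n - 1)) * coord u (n - 1)
    + complex_of_real (a n) * coord u n + complex_of_real (b n) * coord u (n + 1))"

text \<open>The maximum of \<open>\<bar>a i - a 0\<bar>\<close> over \<open>i = 0, 1, 2, \<dots>\<close>; for periodic \<open>a\<close> the set is finite,
  see \<open>finite_osc\<close>.\<close>

definition osc :: "(int \<Rightarrow> real) \<Rightarrow> real"
  where "osc a = Max {\<bar>a (int i) - a 0\<bar> | i. True}"

lemma periodic_mod:
  assumes "periodic p a"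
  shows "a (i mod int p) = a i"
proof -
  have shift: "a (j + int m * int p) = a j" for j m
  proof (induction m)
    case (Suc m)
    have "a (j + int (Suc m) * int p) = a ((j + int m * int p) + int p)"
      by (simp add: algebra_simps)
    with Suc assms show ?case by (simp add: periodic_def)
  qed simp
  have "a (j + m * int p) = a j" for j m
  proof (cases "0 \<le> m")
    case True
    then show ?thesis using shift[of j "nat m"] by simp
  next
    case False
    then show ?thesis using shift[of "j + m * int p" "nat (- m)"] by simp
  qed
  from this[of "i mod int p" "i div int p"] show ?thesis by simp
qed

lemma periodic_range:
  assumes "periodic p a" "p \<ge> 1"
  shows "range a = a ` {0..<int p}"
proof
  show "range a \<subseteq> a ` {0..<int p}"
  proof
    fix x assume "x \<in> range a"
    then obtain i where "x = a i" by auto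
    moreover have "i mod int p \<in> {0..<int p}" using assms(2) by simp
    ultimately show "x \<in> a ` {0..<int p}" using periodic_mod[OF assms(1), of i] by (metis imageI)
  qed
qed auto

lemma finite_osc:
  assumes "periodic p a" "p \<ge> 1"
  shows "finite {\<bar>a (int i) - a 0\<bar> | i. True}"
proof (rule finite_subset)
  show "{\<bar>a (int i) - a 0\<bar> | i. True} \<subseteq> (\<lambda>x. \<bar>x - a 0\<bar>) ` range a" by auto
  show "finite ((\<lambda>x. \<bar>x - a 0\<bar>) ` range a)" using periodic_range[OF assms] by simp
qed

lemma periodic_bounded:
  assumes "periodic p a" "p \<ge> 1"
  shows "\<exists>M. \<forall>n. \<bar>a n\<bar> \<le> M"
proof (intro exI allI)
  have "finite (range (\<lambda>n. \<bar>a n\<bar>))"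
    using periodic_range[OF assms] by (metis finite_atLeastLessThan_int finite_imageI image_image)
  then show "\<bar>a n\<bar> \<le> Max (range (\<lambda>n. \<bar>a n\<bar>))" for n by simp
qed

lemma coord_jacobi:
  assumes "periodic p a" "periodic p b" "periodic p c" "p \<ge> 1"
  shows "coord (jacobi a b c u) n = complex_of_real (c (n - 1)) * coord u (n - 1)
    + complex_of_real (a n) * coord u n + complex_of_real (b n) * coord u (n + 1)"
proof -
  obtain A where A: "\<And>n. \<bar>a n\<bar> \<le> A" using periodic_bounded[OF assms(1,4)] by blast
  obtain B where B: "\<And>n. \<bar>b n\<bar> \<le> B" using periodic_bounded[OF assms(2,4)] by blast
  obtain C where C: "\<And>n. \<bar>c n\<bar> \<le> C" using periodic_bounded[OF assms(3,4)] by blast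
  have u: "square_summable (\<lambda>n. coord u (n - 1))" "square_summable (\<lambda>n. coord u (n + 1))"
    using square_summable_shift[OF square_summable_coord[of u], of "- 1"]
      square_summable_shift[OF square_summable_coord[of u], of 1] by simp_all
  have "square_summable (\<lambda>n. complex_of_real (c (n - 1)) * coord u (n - 1)
    + complex_of_real (a n) * coord u n + complex_of_real (b n) * coord u (n + 1))"
    by (intro square_summable_add square_summable_bounded_mult[OF u(1), where M = C]
        square_summable_bounded_mult[OF square_summable_coord, where M = A]
        square_summable_bounded_mult[OF u(2), where M = B]) (simp_all add: A B C)
  then show ?thesis by (simp add: jacobi_def Abs_ell2_inverse)
qed

lemma bounded_clinear_jacobi:
  assumes "periodic p a" "periodic p b" "periodic p c" "p \<ge> 1"
  shows "bounded_clinear (jacobi a b c)"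
proof -
  note cj = coord_jacobi[OF assms]
  obtain A where A: "\<And>n. \<bar>a n\<bar> \<le> A" using periodic_bounded[OF assms(1,4)] by blast
  obtain B where B: "\<And>n. \<bar>b n\<bar> \<le> B" using periodic_bounded[OF assms(2,4)] by blast
  obtain C where C: "\<And>n. \<bar>c n\<bar> \<le> C" using periodic_bounded[OF assms(3,4)] by blast
  define M where "M = max A (max B C)"
  have M: "\<bar>a n\<bar> \<le> M" "\<bar>b n\<bar> \<le> M" "\<bar>c n\<bar> \<le> M" for n
    using A[of n] B[of n] C[of n] by (auto simp: M_def)
  have "0 \<le> M" using M(1)[of 0] by simp
  have bound: "norm (jacobi a b c u) \<le> norm u * (3 * M)" for u
  proof -
    define s where "s k n = (cmod (coord u (n + k)))\<^sup>2" for k n :: int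
    have s_sum: "(s k) summable_on UNIV" and s_inf: "infsum (s k) UNIV = (norm u)\<^sup>2" for k
    proof -
      have bij: "bij (\<lambda>n::int. n + k)"
        by (intro bij_betw_byWitness[where f' = "\<lambda>n. n - k"]) auto
      show "infsum (s k) UNIV = (norm u)\<^sup>2"
        using infsum_reindex_bij_betw[OF bij, of "\<lambda>n. (cmod (coord u n))\<^sup>2"]
        by (simp add: s_def[abs_def] norm_ell2_power2)
      show "(s k) summable_on UNIV"
        using square_summable_shift[OF square_summable_coord[of u], of k]
        by (simp add: s_def[abs_def] square_summable_def)
    qed
    have le: "(cmod (coord (jacobi a b c u) n))\<^sup>2
      \<le> 3 * M\<^sup>2 * (s (- 1) n + s 0 n + s 1 n)" for n
    proof -
      define x y z where "x = cmod (coord u (n - 1))" and "y = cmod (coord u n)"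
        and "z = cmod (coord u (n + 1))"
      have "cmod (coord (jacobi a b c u) n) \<le> \<bar>c (n - 1)\<bar> * x + \<bar>a n\<bar> * y + \<bar>b n\<bar> * z"
        unfolding cj x_def y_def z_def
        by (intro norm_triangle_mono) (simp_all add: norm_mult)
      also have "\<dots> \<le> M * x + M * y + M * z"
        by (intro add_mono mult_right_mono M) (simp_all add: x_def y_def z_def)
      finally have "(cmod (coord (jacobi a b c u) n))\<^sup>2 \<le> (M * x + M * y + M * z)\<^sup>2"
        by (intro power_mono) simp_all
      also have "\<dots> = M\<^sup>2 * (x + y + z)\<^sup>2"
        by (simp add: power2_eq_square algebra_simps)
      also have "\<dots> \<le> M\<^sup>2 * (3 * (x\<^sup>2 + y\<^sup>2 + z\<^sup>2))"
      proof (rule mult_left_mono)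
        show "(x + y + z)\<^sup>2 \<le> 3 * (x\<^sup>2 + y\<^sup>2 + z\<^sup>2)"
          using sum_squares_bound[of x y] sum_squares_bound[of y z] sum_squares_bound[of x z]
          by (simp add: power2_eq_square algebra_simps)
      qed simp
      also have "\<dots> = 3 * M\<^sup>2 * (s (- 1) n + s 0 n + s 1 n)"
        by (simp add: s_def x_def y_def z_def)
      finally show ?thesis .
    qed
    have "(norm (jacobi a b c u))\<^sup>2 \<le> (\<Sum>\<^sub>\<infinity>n. 3 * M\<^sup>2 * (s (- 1) n + s 0 n + s 1 n))"
      unfolding norm_ell2_power2
      using square_summable_coord[of "jacobi a b c u"] le
      by (intro infsum_mono) (auto simp: square_summable_def intro!: summable_on_cmult_right
          summable_on_add s_sum)
    also have "\<dots> = (3 * M * norm u)\<^sup>2"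
      by (simp add: infsum_cmult_right' infsum_add summable_on_add s_sum s_inf power2_eq_square)
    finally show ?thesis
      using \<open>0 \<le> M\<close> by (simp add: abs_le_square_iff[symmetric] mult.commute)
  qed
  have "bounded_linear (jacobi a b c)"
  proof (rule bounded_linear_intro[OF _ _ bound])
    show "jacobi a b c (u + v) = jacobi a b c u + jacobi a b c v" for u v
      by (rule ell2_eqI) (simp add: cj plus_ell2.rep_eq algebra_simps)
    show "jacobi a b c (r *\<^sub>R u) = r *\<^sub>R jacobi a b c u" for r u
      by (rule ell2_eqI) (simp add: cj scaleR_ell2.rep_eq scaleR_conv_of_real algebra_simps)
  qed
  moreover have "jacobi a b c (z *\<^sub>C u) = z *\<^sub>C jacobi a b c u" for z u
    by (rule ell2_eqI) (simp add: cj scaleC.rep_eq algebra_simps)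
  ultimately show ?thesis by (simp add: bounded_clinear_def)
qed

end

theory Submission
  imports Defs "HOL-Complex_Analysis.Complex_Analysis"
begin

text \<open>
  Suppose $\|A - A_0\| \le e$ and $r > 2e$.  From any point of $\Lambda_r(A)$ there is a path inside
  $\Lambda_r(A)$ to $\sigma(A)$: since matrix elements of the resolvent are holomorphic, its norm has
  no local maximum to be trapped at.  A point of $\sigma(A)$ lies in every $\Lambda_{e'}(A_0)$ with
  $e' > e$, where the same principle, now for $A_0$, yields a path to $\sigma(A_0)$; for
  $e' = r - e$ it stays inside $\Lambda_r(A)$.  Hence $\Lambda_r(A)$ is path-connected as soon as
  $\sigma(A_0)$ is.  Because $b_i - c_i$ is constant, $J$ is close to a Jacobi operator with constant
  coefficients, whose spectrum is the ellipse
  $\{\alpha + \beta\zeta + \gamma\overline{\zeta} : |\zeta| = 1\}$, and the given $r$ is large enough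
  for this comparison.
\<close>

section \<open>Invertible operators bounded below\<close>

text \<open>The operator need not be normal, so the resolvent norm is not determined by the distance
  to the spectrum, and a pseudospectrum cannot be handled as a union of discs about spectral points.
  The maximum principle ties its points to the spectrum instead, but it speaks of components, and
  these are known to be path components only for open sets. The definition has \<open>>=\<close>, so
  \<open>open_pseudo\<close> carries the argument on components and the points of equality are
  treated separately. Origin of the comparison constant: with off-diagonals beta and beta - k, the
  deviations b_n - beta and c_n - (beta - k) coincide, so freezing the coefficients at 0 costs e =
  wa + 2 wb. By Cauchy-Schwarz, e^2 <= 3 (wa^2 + 2 wb^2); hence 2 e < r follows from 12 < 9 (p - 1)
  unless both oscillations vanish.\<close>

lemma scaleC_add_right: "c *\<^sub>C (u + v) = c *\<^sub>C u + c *\<^sub>C v"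
  and scaleC_diff_left: "(c - d) *\<^sub>C u = c *\<^sub>C u - d *\<^sub>C u"
  and scaleC_diff_right: "c *\<^sub>C (u - v) = c *\<^sub>C u - c *\<^sub>C v"
  and scaleC_scaleC: "c *\<^sub>C d *\<^sub>C u = (c * d) *\<^sub>C u"
  and scaleC_one: "1 *\<^sub>C u = u"
  and scaleC_minus_left: "(- c) *\<^sub>C u = - (c *\<^sub>C u)"
  by (transfer, simp add: algebra_simps)+

lemmas scaleC_simps = scaleC_add_right scaleC_diff_left scaleC_diff_right scaleC_scaleC scaleC_one
  scaleC_minus_left

lemma scaleC_of_real: "complex_of_real r *\<^sub>C u = r *\<^sub>R u"
  by transfer (simp add: scaleR_conv_of_real)

lemma norm_scaleC: "norm (c *\<^sub>C u) = cmod c * norm u"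
proof -
  have "(norm (c *\<^sub>C u))\<^sup>2 = (cmod c * norm u)\<^sup>2"
    by (simp add: norm_ell2_power2 scaleC.rep_eq norm_mult power_mult_distrib infsum_cmult_right')
  then show ?thesis by simp
qed

text \<open>For linear \<open>T\<close> and \<open>0 < m\<close> this says that \<open>T\<close> has a bounded inverse of norm at most \<open>1 / m\<close>;
  phrased with \<open>m\<close> instead of \<open>1 / m\<close>, perturbing \<open>T\<close> by an operator of norm \<open>\<delta>\<close> merely lowers \<open>m\<close>
  by \<open>\<delta>\<close>.\<close>

definition inv_below :: "(ell2 \<Rightarrow> ell2) \<Rightarrow> real \<Rightarrow> bool"
  where "inv_below T m \<longleftrightarrow> surj T \<and> (\<forall>u. m * norm u \<le> norm (T u))"

definition pencil :: "(ell2 \<Rightarrow> ell2) \<Rightarrow> complex \<Rightarrow> ell2 \<Rightarrow> ell2"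
  where "pencil A z u = z *\<^sub>C u - A u"

lemma inv_below_mono: "inv_below T m \<Longrightarrow> m' \<le> m \<Longrightarrow> inv_below T m'"
  unfolding inv_below_def by (meson mult_right_mono norm_ge_zero order_trans)

lemma inv_below_comp:
  assumes "inv_below T m" "inv_below T' m'" "0 \<le> m"
  shows "inv_below (\<lambda>u. T (T' u)) (m * m')"
proof -
  have "surj (T \<circ> T')" using assms unfolding inv_below_def by (intro comp_surj) auto
  moreover have "m * m' * norm u \<le> norm (T (T' u))" for u
  proof -
    have "m * (m' * norm u) \<le> m * norm (T' u)"
      using assms by (intro mult_left_mono) (auto simp: inv_below_def)
    also have "\<dots> \<le> norm (T (T' u))" using assms by (auto simp: inv_below_def)
    finally show ?thesis by (simp add: mult.assoc)
  qed
  ultimately show ?thesis by (simp add: inv_below_def comp_def)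
qed

lemma inv_below_scaleC:
  assumes "c \<noteq> 0"
  shows "inv_below (\<lambda>u. c *\<^sub>C u) (cmod c)"
proof -
  have "surj (\<lambda>u. c *\<^sub>C u)"
    using assms by (intro surjI[of _ "\<lambda>u. (1 / c) *\<^sub>C u"]) (simp add: scaleC_simps)
  then show ?thesis by (simp add: inv_below_def norm_scaleC)
qed

lemma bounded_clinear_linear: "bounded_clinear A \<Longrightarrow> linear A"
  by (simp add: bounded_clinear_def bounded_linear.linear)

lemma bounded_clinear_scaleC: "bounded_clinear A \<Longrightarrow> A (c *\<^sub>C u) = c *\<^sub>C A u"
  by (simp add: bounded_clinear_def)

lemma linear_scaleC: "linear (\<lambda>u. z *\<^sub>C u)"
  by (rule linearI) (simp_all add: scaleC_simps mult.commute flip: scaleC_of_real)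

lemma linear_pencil: "bounded_clinear A \<Longrightarrow> linear (pencil A z)"
  unfolding pencil_def[abs_def]
  by (intro linear_compose_sub linear_scaleC bounded_clinear_linear)

lemma pencil_scaleC: "bounded_clinear A \<Longrightarrow> pencil A z (c *\<^sub>C u) = c *\<^sub>C pencil A z u"
  by (simp add: pencil_def bounded_clinear_scaleC scaleC_simps mult.commute)

text \<open>Surjectivity is a fixed point problem: \<open>T x + D x = y\<close> means that
  \<open>x\<close> is fixed by the map sending \<open>x\<close> to the preimage of
  \<open>y - D x\<close> under \<open>T\<close>, a contraction with factor
  \<open>\<delta> / m\<close>. The lower bound is the triangle inequality.\<close>

lemma inv_below_perturb:
  assumes T: "linear T" "inv_below T m" and D: "linear D" "\<And>u. norm (D u) \<le> \<delta> * norm u"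
    and "\<delta> < m" "0 \<le> \<delta>"
  shows "inv_below (\<lambda>u. T u + D u) (m - \<delta>)"
proof -
  have lower: "m * norm u \<le> norm (T u)" for u using T(2) unfolding inv_below_def by blast
  have "\<exists>x. T x + D x = y" for y
  proof -
    define B where "B = inv T"
    have TB: "T (B v) = v" for v
      using T(2) unfolding B_def inv_below_def by (blast intro: surj_f_inv_f)
    define F where "F x = B (y - D x)" for x
    have "dist (F x) (F x') \<le> \<delta> / m * dist x x'" for x x'
    proof -
      have "m * norm (F x - F x') \<le> norm (T (F x - F x'))" by (rule lower)
      also have "T (F x - F x') = D (x' - x)"
        by (simp add: linear_diff[OF T(1)] linear_diff[OF D(1)] F_def TB)
      also have "norm \<dots> \<le> \<delta> * norm (x - x')"
        using D(2)[of "x' - x"] by (simp add: norm_minus_commute)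
      finally have "norm (F x - F x') \<le> \<delta> * norm (x - x') / m"
        using assms(5,6) by (subst pos_le_divide_eq) (simp_all add: mult.commute)
      then show ?thesis by (simp add: dist_norm)
    qed
    then have "\<exists>!x. F x = x"
      using assms(5,6) by (intro banach_fix_type[of "\<delta> / m"]) simp_all
    then obtain x where "F x = x" by blast
    then have "T x = y - D x" using TB[of "y - D x"] unfolding F_def by (simp only:)
    then have "T x + D x = y" by simp
    then show ?thesis by blast
  qed
  then have "surj (\<lambda>u. T u + D u)" unfolding surj_def by (blast intro: sym)
  moreover have "(m - \<delta>) * norm u \<le> norm (T u + D u)" for u
    using lower[of u] D(2)[of u] norm_diff_ineq[of "T u" "D u"] by (simp add: algebra_simps)
  ultimately show ?thesis by (simp add: inv_below_def)
qed

lemma inv_below_pencil_shift: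
  assumes A: "bounded_clinear A" and "inv_below (pencil A z) m" "cmod (w - z) < m"
  shows "inv_below (pencil A w) (m - cmod (w - z))"
proof -
  have "inv_below (\<lambda>u. pencil A z u + (w - z) *\<^sub>C u) (m - cmod (w - z))"
    by (rule inv_below_perturb[OF linear_pencil[OF A] assms(2) linear_scaleC])
      (use assms(3) in \<open>simp_all add: norm_scaleC\<close>)
  moreover have "(\<lambda>u. pencil A z u + (w - z) *\<^sub>C u) = pencil A w"
    by (simp add: fun_eq_iff pencil_def scaleC_diff_left)
  ultimately show ?thesis by simp
qed

lemma inv_below_pencil_perturb:
  assumes A: "bounded_clinear A" and A': "bounded_clinear A'"
    and close: "\<And>u. norm (A u - A' u) \<le> e * norm u"
    and "inv_below (pencil A z) m" "e < m" "0 \<le> e"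
  shows "inv_below (pencil A' z) (m - e)"
proof -
  have "inv_below (\<lambda>u. pencil A z u + (A u - A' u)) (m - e)"
    by (rule inv_below_perturb[OF linear_pencil[OF A] assms(4) _ close assms(5,6)])
      (intro linear_compose_sub bounded_clinear_linear A A')
  moreover have "(\<lambda>u. pencil A z u + (A u - A' u)) = pencil A' z"
    by (simp add: fun_eq_iff pencil_def)
  ultimately show ?thesis by simp
qed

section \<open>Spectrum and pseudospectrum in terms of \<open>inv_below\<close>\<close>

lemma not_in_spectrum_iff:
  assumes A: "bounded_clinear A"
  shows "z \<notin> spectrum A \<longleftrightarrow> (\<exists>m>0. inv_below (pencil A z) m)"
proof
  assume "z \<notin> spectrum A"
  then obtain B where B: "bounded_clinear B" "\<And>u. B (pencil A z u) = u" "\<And>u. pencil A z (B u) = u"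
    by (auto simp: spectrum_def pencil_def)
  obtain K where K: "K > 0" "\<And>u. norm (B u) \<le> norm u * K"
    using bounded_linear.pos_bounded[of B] B(1) unfolding bounded_clinear_def by blast
  have "1 / K * norm u \<le> norm (pencil A z u)" for u
    using K(1) K(2)[of "pencil A z u"] by (simp add: B(2) field_simps)
  moreover have "surj (pencil A z)" using B(3) by (metis surjI)
  ultimately show "\<exists>m>0. inv_below (pencil A z) m"
    using K(1) by (intro exI[of _ "1 / K"]) (simp add: inv_below_def)
next
  assume "\<exists>m>0. inv_below (pencil A z) m"
  then obtain m where m: "m > 0" "surj (pencil A z)" "\<And>u. m * norm u \<le> norm (pencil A z u)"
    by (auto simp: inv_below_def)
  define B where "B = inv (pencil A z)"
  have TB: "pencil A z (B u) = u" for u using m(2) by (simp add: B_def surj_f_inv_f)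
  have inj: "u = v" if "pencil A z u = pencil A z v" for u v
    using m(3)[of "u - v"] m(1) that by (simp add: linear_diff[OF linear_pencil[OF A]] mult_le_0_iff)
  have "bounded_linear B"
  proof (rule bounded_linear_intro)
    show "B (u + v) = B u + B v" for u v
      by (rule inj) (simp add: TB linear_add[OF linear_pencil[OF A]])
    show "B (r *\<^sub>R u) = r *\<^sub>R B u" for r u
      by (rule inj) (simp add: TB linear_scale[OF linear_pencil[OF A]])
    show "norm (B u) \<le> norm u * (1 / m)" for u
      using m(1) m(3)[of "B u"] by (simp add: TB field_simps)
  qed
  moreover have "B (c *\<^sub>C u) = c *\<^sub>C B u" for c u
    by (rule inj) (simp add: TB pencil_scaleC[OF A])
  moreover have "B (pencil A z u) = u" for u by (rule inj) (simp add: TB)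
  ultimately show "z \<notin> spectrum A"
    using TB unfolding spectrum_def pencil_def bounded_clinear_def by blast
qed

lemma resolvent_eq: "resolvent A z = inv (pencil A z)"
  by (simp add: resolvent_def pencil_def[abs_def])

lemma resolvent_facts:
  assumes A: "bounded_clinear A" and z: "z \<notin> spectrum A"
  shows pencil_resolvent: "pencil A z (resolvent A z u) = u"
    and resolvent_pencil: "resolvent A z (pencil A z u) = u"
    and bounded_clinear_resolvent: "bounded_clinear (resolvent A z)"
proof -
  obtain B where B: "bounded_clinear B" "\<And>u. B (pencil A z u) = u" "\<And>u. pencil A z (B u) = u"
    using z by (auto simp: spectrum_def pencil_def)
  have "resolvent A z = B" unfolding resolvent_eq
    by (rule inv_equality) (auto simp: B)
  with B show "pencil A z (resolvent A z u) = u" "resolvent A z (pencil A z u) = u"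
    "bounded_clinear (resolvent A z)" by auto
qed

lemma norm_resolvent_le:
  assumes "bounded_clinear A" "z \<notin> spectrum A" "inv_below (pencil A z) m"
  shows "m * norm (resolvent A z u) \<le> norm u"
  using assms(3) pencil_resolvent[OF assms(1,2), of u] by (metis inv_below_def)

text \<open>The \<open>>=\<close> in the definition negates to a strict bound on the resolvent norm,
  that is, to a lower bound by some \<open>m > r\<close> and not merely by \<open>r\<close>. In this
  form \<open>r = 0\<close> gives the spectrum.\<close>

lemma pseudospectrum_iff:
  assumes A: "bounded_clinear A" and r: "r \<ge> 0"
  shows "z \<in> pseudospectrum r A \<longleftrightarrow> \<not> (\<exists>m>r. inv_below (pencil A z) m)"
proof (cases "z \<in> spectrum A \<or> r = 0")
  case True
  then show ?thesis
    using not_in_spectrum_iff[OF A, of z] r by (auto simp: pseudospectrum_def)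
next
  case False
  then have z: "z \<notin> spectrum A" and r: "r > 0" using r by auto
  note R = bounded_clinear_resolvent[OF A z, unfolded bounded_clinear_def, THEN conjunct1]
  have "onorm (resolvent A z) < inverse r \<longleftrightarrow> (\<exists>m>r. inv_below (pencil A z) m)"
  proof
    assume less: "onorm (resolvent A z) < inverse r"
    \<comment> \<open>\<open>onorm\<close> is only known to be nonnegative; the midpoint is
      positive, so it can be inverted, and still less than \<open>inverse r\<close>.\<close>
    define M where "M = (onorm (resolvent A z) + inverse r) / 2"
    have M: "0 < M" "onorm (resolvent A z) \<le> M" "M < inverse r"
      using less r onorm_pos_le[OF R] by (auto simp: M_def)
    have "1 / M * norm u \<le> norm (pencil A z u)" for u
    proof -
      have "norm u \<le> onorm (resolvent A z) * norm (pencil A z u)"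
        using onorm[OF R, of "pencil A z u"] by (simp add: resolvent_pencil[OF A z])
      also have "\<dots> \<le> M * norm (pencil A z u)" using M by (intro mult_right_mono) auto
      finally show ?thesis using M(1) by (simp add: field_simps)
    qed
    moreover have "surj (pencil A z)" using pencil_resolvent[OF A z] by (metis surjI)
    moreover have "r < 1 / M" using M r by (simp add: field_simps)
    ultimately show "\<exists>m>r. inv_below (pencil A z) m" by (auto simp: inv_below_def)
  next
    assume "\<exists>m>r. inv_below (pencil A z) m"
    then obtain m where m: "m > r" "inv_below (pencil A z) m" by blast
    have "onorm (resolvent A z) \<le> 1 / m"
      using m r norm_resolvent_le[OF A z m(2)] by (intro onorm_bound) (auto simp: field_simps)
    also have "\<dots> < inverse r" using m r by (simp add: field_simps)
    finally show "onorm (resolvent A z) < inverse r" .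
  qed
  then show ?thesis using z r unfolding pseudospectrum_def by (simp add: not_less[symmetric])
qed

section \<open>Components of pseudospectra\<close>

text \<open>The complex linear functional represented by \<open>v\<close>: its imaginary part is forced by complex
  linearity, since the inner product of \<open>ell2\<close> is only the real one.\<close>

definition cfun :: "ell2 \<Rightarrow> ell2 \<Rightarrow> complex"
  where "cfun v u = Complex (inner u v) (- inner (\<i> *\<^sub>C u) v)"

lemma cfun_diff: "cfun v (x - y) = cfun v x - cfun v y"
  by (simp add: cfun_def complex_eq_iff scaleC_simps inner_diff_left)

lemma scaleC_decompose: "c *\<^sub>C u = Re c *\<^sub>R u + Im c *\<^sub>R (\<i> *\<^sub>C u)"
  by transfer (simp add: fun_eq_iff complex_eq_iff)

lemma cfun_scaleC: "cfun v (c *\<^sub>C u) = c * cfun v u"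
proof -
  have "\<i> *\<^sub>C c *\<^sub>C u = Re c *\<^sub>R (\<i> *\<^sub>C u) - Im c *\<^sub>R u"
    by transfer (simp add: fun_eq_iff complex_eq_iff)
  then show ?thesis
    unfolding cfun_def
    by (simp only: scaleC_decompose[of c u])
      (simp add: complex_eq_iff inner_add_left inner_diff_left)
qed

text \<open>The real Cauchy-Schwarz inequality controls only the real part of
  \<open>cfun v u\<close>; rotating \<open>u\<close> by a unimodular \<open>c\<close> makes the
  value real and nonnegative.\<close>

lemma norm_cfun_le: "cmod (cfun v u) \<le> norm u * norm v"
proof (cases "cfun v u = 0")
  case False
  define c where "c = cnj (sgn (cfun v u))"
  have c: "cmod c = 1" using False by (simp add: c_def norm_sgn)
  have "cfun v (c *\<^sub>C u) = of_real (cmod (cfun v u))"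
    unfolding cfun_scaleC c_def using False
    by (simp add: sgn_eq complex_norm_square power2_eq_square[symmetric] mult.commute
        nonzero_divide_eq_eq flip: of_real_power)
  then have "cmod (cfun v u) = inner (c *\<^sub>C u) v"
    by (simp add: cfun_def complex_eq_iff)
  also have "\<dots> \<le> norm (c *\<^sub>C u) * norm v" by (rule norm_cauchy_schwarz)
  finally show ?thesis by (simp add: norm_scaleC c)
qed simp

text \<open>The witness is \<open>u\<close> normalised. The bound \<open>norm v \<le> 1\<close>
  instead of equality admits \<open>u = 0\<close>, where the division returns 0.\<close>

lemma norming_cfun:
  obtains v where "norm v \<le> 1" "norm u \<le> cmod (cfun v u)"
proof
  show "norm (u /\<^sub>R norm u) \<le> 1" by (simp add: divide_simps)
  have "norm u = inner u (u /\<^sub>R norm u)"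
    by (simp add: power2_norm_eq_inner[symmetric] power2_eq_square divide_simps)
  also have "\<dots> \<le> cmod (cfun (u /\<^sub>R norm u) u)"
    using complex_Re_le_cmod[of "cfun (u /\<^sub>R norm u) u"] by (simp add: cfun_def)
  finally show "norm u \<le> cmod (cfun (u /\<^sub>R norm u) u)" .
qed

section \<open>Analyticity of the resolvent\<close>

lemma closed_spectrum:
  assumes A: "bounded_clinear A"
  shows "closed (spectrum A)"
proof -
  have "open (- spectrum A)"
  proof (rule openI)
    fix z assume "z \<in> - spectrum A"
    then obtain m where m: "m > 0" "inv_below (pencil A z) m"
      using not_in_spectrum_iff[OF A, of z] by blast
    have "ball z m \<subseteq> - spectrum A"
    proof
      fix w assume "w \<in> ball z m"
      then have "cmod (w - z) < m" by (simp add: dist_norm norm_minus_commute)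
      with inv_below_pencil_shift[OF A m(2) this] show "w \<in> - spectrum A"
        using not_in_spectrum_iff[OF A, of w] by (metis ComplI diff_gt_0_iff_gt)
    qed
    with m(1) show "\<exists>e>0. ball z e \<subseteq> - spectrum A" by blast
  qed
  then show ?thesis by (simp add: closed_def)
qed

text \<open>With \<open>x = resolvent A z y\<close>, apply the resolvent at \<open>w\<close> to
  \<open>pencil A w x = y + (w - z) *\<^sub>C x\<close>.\<close>

lemma resolvent_identity:
  assumes A: "bounded_clinear A" and z: "z \<notin> spectrum A" and w: "w \<notin> spectrum A"
  shows "resolvent A w y - resolvent A z y = - ((w - z) *\<^sub>C resolvent A w (resolvent A z y))"
proof -
  define x where "x = resolvent A z y"
  have y: "pencil A z x = y" by (simp add: x_def pencil_resolvent[OF A z])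
  have lin: "linear (resolvent A w)"
    using bounded_clinear_resolvent[OF A w] by (rule bounded_clinear_linear)
  have "pencil A w x = y + (w - z) *\<^sub>C x"
    unfolding y[symmetric] by (simp add: pencil_def scaleC_diff_left)
  then have "x = resolvent A w (y + (w - z) *\<^sub>C x)"
    using resolvent_pencil[OF A w, of x] by simp
  also have "\<dots> = resolvent A w y + (w - z) *\<^sub>C resolvent A w x"
    by (simp add: linear_add[OF lin] bounded_clinear_scaleC[OF bounded_clinear_resolvent[OF A w]])
  finally show ?thesis by (simp add: x_def algebra_simps)
qed

text \<open>By the resolvent identity and a bound uniform near \<open>z\<close>, the function is
  continuous. The same identity turns its difference quotient into minus the function for the vector
  \<open>resolvent A z y\<close>, so continuity for that vector gives the derivative; hence
  \<open>cont\<close> is stated for all \<open>y\<close>.\<close>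

lemma holomorphic_cfun_resolvent:
  assumes A: "bounded_clinear A"
  shows "(\<lambda>x. cfun v (resolvent A x y)) holomorphic_on - spectrum A"
proof -
  have op: "open (- spectrum A)" using closed_spectrum[OF A] by (simp add: open_Compl)
  have cont: "((\<lambda>x. cfun v (resolvent A x y)) \<longlongrightarrow> cfun v (resolvent A z y)) (at z)"
    if z: "z \<notin> spectrum A" for z y
  proof -
    obtain m where m: "m > 0" "inv_below (pencil A z) m"
      using not_in_spectrum_iff[OF A, of z] z by blast
    define K where "K = norm (resolvent A z y) * norm v / (m / 2)"
    have bd: "cmod (cfun v (resolvent A x y) - cfun v (resolvent A z y)) \<le> cmod (x - z) * K"
      if x: "dist x z < m / 2" for x
    proof -
      have xz: "cmod (x - z) < m / 2" using x by (simp add: dist_norm)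
      have ib: "inv_below (pencil A x) (m / 2)"
        using inv_below_pencil_shift[OF A m(2), of x] xz m(1)
        by (intro inv_below_mono[of _ "m - cmod (x - z)" "m / 2"]) auto
      have xs: "x \<notin> spectrum A"
        using ib m(1) not_in_spectrum_iff[OF A, of x] half_gt_zero by blast
      have "norm (resolvent A x (resolvent A z y)) \<le> norm (resolvent A z y) / (m / 2)"
        using norm_resolvent_le[OF A xs ib, of "resolvent A z y"] m(1)
        by (subst pos_le_divide_eq) (auto simp: mult.commute)
      then have "cmod (cfun v (resolvent A x (resolvent A z y)))
          \<le> norm (resolvent A z y) / (m / 2) * norm v"
        by (rule order_trans[OF norm_cfun_le mult_right_mono]) simp
      then have le: "cmod (cfun v (resolvent A x (resolvent A z y))) \<le> K"
        by (simp add: K_def mult_ac)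
      have "cmod (cfun v (resolvent A x y) - cfun v (resolvent A z y))
          = cmod (cfun v (resolvent A x y - resolvent A z y))"
        by (simp add: cfun_diff)
      also have "\<dots> = cmod (x - z) * cmod (cfun v (resolvent A x (resolvent A z y)))"
        unfolding resolvent_identity[OF A z xs] scaleC_minus_left[symmetric] cfun_scaleC norm_mult
        by (simp add: norm_minus_commute)
      also have "\<dots> \<le> cmod (x - z) * K" by (rule mult_left_mono[OF le]) simp
      finally show ?thesis .
    qed
    have "((\<lambda>x. cmod (x - z) * K) \<longlongrightarrow> cmod (z - z) * K) (at z)" by (intro tendsto_intros)
    then have "((\<lambda>x. cmod (x - z) * K) \<longlongrightarrow> 0) (at z)" by simp
    then have "((\<lambda>x. cfun v (resolvent A x y) - cfun v (resolvent A z y)) \<longlongrightarrow> 0) (at z)"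
      by (rule Lim_null_comparison[rotated])
        (use bd m(1) in \<open>auto simp: eventually_at intro!: exI[of _ "m / 2"]\<close>)
    then show ?thesis by (simp add: LIM_zero_iff)
  qed
  have "(\<lambda>x. cfun v (resolvent A x y)) field_differentiable at z" if z: "z \<in> - spectrum A" for z
  proof -
    let ?y = "resolvent A z y"
    have "((\<lambda>x. - cfun v (resolvent A x ?y)) \<longlongrightarrow> - cfun v (resolvent A z ?y)) (at z)"
      using z by (intro tendsto_minus cont) simp
    then have "((\<lambda>x. (cfun v (resolvent A x y) - cfun v (resolvent A z y)) / (x - z))
        \<longlongrightarrow> - cfun v (resolvent A z ?y)) (at z)"
    proof (rule Lim_transform_within_open[OF _ op z])
      fix x assume x: "x \<in> - spectrum A" "x \<noteq> z"
      have "cfun v (resolvent A x y) - cfun v (resolvent A z y)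
          = - (x - z) * cfun v (resolvent A x ?y)"
        using x z unfolding cfun_diff[symmetric]
        by (subst resolvent_identity[OF A]) (simp_all only: Compl_iff not_False_eq_True scaleC_minus_left[symmetric] cfun_scaleC)
      then show "- cfun v (resolvent A x ?y)
          = (cfun v (resolvent A x y) - cfun v (resolvent A z y)) / (x - z)"
        using x(2) by (simp add: field_simps)
    qed
    then have "((\<lambda>x. cfun v (resolvent A x y)) has_field_derivative - cfun v (resolvent A z ?y)) (at z)"
      by (simp add: has_field_derivative_iff)
    then show ?thesis unfolding field_differentiable_def by blast
  qed
  then show ?thesis by (simp add: holomorphic_on_def field_differentiable_at_within)
qed

lemma norm_cfun_resolvent_le:
  assumes A: "bounded_clinear A" and z: "inv_below (pencil A z) m" "0 < m"
    and v: "norm v \<le> 1"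
  shows "cmod (cfun v (resolvent A z y)) \<le> norm y / m"
proof -
  have zs: "z \<notin> spectrum A" using not_in_spectrum_iff[OF A] z by blast
  have "cmod (cfun v (resolvent A z y)) \<le> norm (resolvent A z y) * norm v" by (rule norm_cfun_le)
  also have "\<dots> \<le> norm (resolvent A z y) * 1" by (intro mult_left_mono v) simp
  also have "\<dots> \<le> norm y / m"
    using norm_resolvent_le[OF A zs z(1), of y] z(2)
    by (simp add: pos_le_divide_eq mult.commute)
  finally show ?thesis .
qed

text \<open>For \<open>0 < r\<close> the pseudospectrum defined by the strict inequality
  $\|(zI - A)^{-1}\| > r^{-1}$.\<close>

definition open_pseudo :: "real \<Rightarrow> (ell2 \<Rightarrow> ell2) \<Rightarrow> complex set"
  where "open_pseudo r A = {z. \<not> inv_below (pencil A z) r}"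

lemma spectrum_subset_open_pseudo: "bounded_clinear A \<Longrightarrow> r > 0 \<Longrightarrow> spectrum A \<subseteq> open_pseudo r A"
  unfolding open_pseudo_def using not_in_spectrum_iff by blast

lemma open_pseudo_subset: "bounded_clinear A \<Longrightarrow> r \<ge> 0 \<Longrightarrow> open_pseudo r A \<subseteq> pseudospectrum r A"
  unfolding open_pseudo_def using pseudospectrum_iff inv_below_mono less_imp_le by blast

text \<open>On the complement, a nearby point of a convergent sequence gives
  \<open>inv_below\<close> at the limit for every constant less than \<open>r\<close>: surjectivity
  follows at once, the bound with \<open>r\<close> itself by letting the loss tend to 0.\<close>

lemma open_open_pseudo:
  assumes A: "bounded_clinear A" and r: "r > 0"
  shows "open (open_pseudo r A)"
proof -
  have "closed {z. inv_below (pencil A z) r}"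
    unfolding closed_sequential_limits
  proof (intro allI impI, elim conjE)
    fix X z assume X: "\<forall>n. X n \<in> {z. inv_below (pencil A z) r}" and "X \<longlonglongrightarrow> z"
    have ib: "inv_below (pencil A z) (r - e)" if e: "0 < e" "e < r" for e
    proof -
      obtain n where n: "cmod (X n - z) < e"
        using LIMSEQ_D[OF \<open>X \<longlonglongrightarrow> z\<close> e(1)] by blast
      then have "inv_below (pencil A z) (r - cmod (z - X n))"
        using X e(2) by (intro inv_below_pencil_shift[OF A]) (auto simp: norm_minus_commute)
      then show ?thesis by (rule inv_below_mono) (use n in \<open>simp add: norm_minus_commute\<close>)
    qed
    have "r * norm u \<le> norm (pencil A z u)" for u
    proof (rule field_le_epsilon)
      fix e :: real assume e: "0 < e"
      \<comment> \<open>\<open>r / 2\<close> keeps the loss below \<open>r\<close>, as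
        \<open>ib\<close> demands; the \<open>+ 1\<close> covers \<open>u = 0\<close>.\<close>
      define d where "d = min (r / 2) (e / (norm u + 1))"
      have d: "0 < d" "d < r" "d \<le> e / (norm u + 1)" using e r by (auto simp: d_def add_nonneg_pos)
      have "d * norm u \<le> d * (norm u + 1)" using d by simp
      also have "\<dots> \<le> e" using d(3) by (simp add: pos_le_divide_eq add_nonneg_pos)
      finally have "d * norm u \<le> e" .
      moreover have "(r - d) * norm u \<le> norm (pencil A z u)"
        using ib[OF d(1,2)] by (simp add: inv_below_def)
      ultimately show "r * norm u \<le> norm (pencil A z u) + e" by (simp add: algebra_simps)
    qed
    then show "z \<in> {z. inv_below (pencil A z) r}"
      using ib[of "r / 2"] r by (simp add: inv_below_def)
  qed
  then show ?thesis by (simp add: open_pseudo_def closed_def Compl_eq)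
qed

text \<open>For large \<open>z\<close> the operator is a small perturbation of multiplication by
  \<open>z\<close>. Maximum modulus needs this boundedness.\<close>

lemma bounded_open_pseudo:
  assumes A: "bounded_clinear A"
  shows "bounded (open_pseudo r A)"
proof -
  obtain K where K: "K > 0" "\<And>u. norm (A u) \<le> norm u * K"
    using bounded_linear.pos_bounded[of A] A unfolding bounded_clinear_def by blast
  have "cmod z \<le> \<bar>r\<bar> + K" if "z \<in> open_pseudo r A" for z
  proof (rule ccontr)
    assume "\<not> cmod z \<le> \<bar>r\<bar> + K"
    then have z: "cmod z > \<bar>r\<bar> + K" "z \<noteq> 0" using K(1) by auto
    have "inv_below (\<lambda>u. z *\<^sub>C u) (cmod z)" using z(2) by (rule inv_below_scaleC)
    then have "inv_below (\<lambda>u. z *\<^sub>C u + - A u) (cmod z - K)"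
      using K z by (intro inv_below_perturb linear_scaleC linear_compose_neg bounded_clinear_linear[OF A])
        (auto simp: mult.commute)
    then have "inv_below (pencil A z) (cmod z - K)"
      by (simp add: pencil_def[abs_def])
    then have "inv_below (pencil A z) r" by (rule inv_below_mono) (use z(1) in simp)
    with that show False by (simp add: open_pseudo_def)
  qed
  then show ?thesis by (auto simp: bounded_iff)
qed

text \<open>On a component without spectrum, maximum modulus applied to the functions
  $x \mapsto \langle (xI - A)^{-1} y, v\rangle$ would bound the resolvent by its size on the boundary.\<close>

lemma component_meets_spectrum:
  assumes A: "bounded_clinear A" and r: "r > 0" and z: "z \<in> open_pseudo r A"
  obtains w where "w \<in> spectrum A" "path_component (open_pseudo r A) z w"
proof -
  define C where "C = connected_component_set (open_pseudo r A) z"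
  have O: "open (open_pseudo r A)" by (rule open_open_pseudo[OF A r])
  have C: "open C" unfolding C_def by (rule open_connected_component[OF O])
  have sub: "C \<subseteq> open_pseudo r A" unfolding C_def by (rule connected_component_subset)
  have zC: "z \<in> C" using z by (simp add: C_def)
  have "C \<inter> spectrum A \<noteq> {}"
  proof
    assume disj: "C \<inter> spectrum A = {}"
    \<comment> \<open>The frontier of a component lies in the frontier of the whole set, and an open
      set is disjoint from its frontier.\<close>
    have fr: "inv_below (pencil A x) r" if "x \<in> frontier C" for x
    proof -
      have "x \<in> frontier (open_pseudo r A)"
        using that frontier_of_connected_component_subset unfolding C_def by blast
      then have "x \<notin> open_pseudo r A" using O by (simp add: frontier_def interior_open)
      then show ?thesis by (simp add: open_pseudo_def)
    qed
    then have "frontier C \<subseteq> - spectrum A" using not_in_spectrum_iff[OF A] r by blast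
    then have cl: "closure C \<subseteq> - spectrum A" using disj by (auto simp: closure_Un_frontier)
    have zs: "z \<notin> spectrum A" using cl zC closure_subset by blast
    \<comment> \<open>Off the spectrum surjectivity holds, so membership in
      \<open>open_pseudo\<close> can only come from a vector violating the lower bound.\<close>
    have "surj (pencil A z)" using pencil_resolvent[OF A zs] by (metis surjI)
    then obtain u where u: "norm (pencil A z u) < r * norm u"
      using z by (auto simp: open_pseudo_def inv_below_def not_le)
    obtain v where v: "norm v \<le> 1" "norm u \<le> cmod (cfun v u)" by (rule norming_cfun)
    define y where "y = pencil A z u"
    define h where "h = (\<lambda>x. cfun v (resolvent A x y))"
    have hol: "h holomorphic_on - spectrum A"
      unfolding h_def by (rule holomorphic_cfun_resolvent[OF A])
    have "cmod (h z) \<le> norm y / r"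
    proof (rule maximum_modulus_frontier[OF _ _ _ _ zC])
      show "h holomorphic_on interior C"
        using hol cl by (rule holomorphic_on_subset[OF _ order_trans[OF order_trans[OF interior_subset closure_subset]]])
      show "continuous_on (closure C) h"
        using hol cl by (meson continuous_on_subset holomorphic_on_imp_continuous_on)
      show "bounded C" using bounded_open_pseudo[OF A] sub by (rule bounded_subset)
      show "cmod (h x) \<le> norm y / r" if "x \<in> frontier C" for x
        unfolding h_def by (rule norm_cfun_resolvent_le[OF A fr[OF that] r v(1)])
    qed
    moreover have "h z = cfun v u" by (simp add: h_def y_def resolvent_pencil[OF A zs])
    ultimately have "r * cmod (cfun v u) \<le> norm (pencil A z u)"
      using r by (simp add: y_def pos_le_divide_eq mult.commute)
    moreover have "r * norm u \<le> r * cmod (cfun v u)" using v(2) r by simp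
    ultimately show False using u by linarith
  qed
  then obtain w where w: "w \<in> C" "w \<in> spectrum A" by blast
  have "path_component (open_pseudo r A) z w"
    using w(1) path_component_eq_connected_component_set[OF open_imp_locally_path_connected[OF O], of z] by (auto simp: C_def)
  with w(2) show thesis by (rule that)
qed

text \<open>Only points with $\|(zI - A)^{-1}\| = 1/r$ matter.  The norm need not be attained, but by Montel
  a maximising sequence of functions $x \mapsto \langle (xI - A)^{-1} y_n, v_n\rangle$ has a limit \<open>h\<close> with
  $|h(z)| = 1/r$ and $|h(x)| \le \|(xI - A)^{-1}\|$ near \<open>z\<close>.  If \<open>h\<close> is not constant, its leading
  Taylor term gives a segment from \<open>z\<close> along which $|h|$ exceeds $1/r$; otherwise the whole
  disc up to the nearest spectral point \<open>w\<close> lies in the pseudospectrum.\<close>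

lemma path_to_open_pseudo:
  assumes A: "bounded_clinear A" and r: "r > 0" and ne: "spectrum A \<noteq> {}"
    and z: "z \<in> pseudospectrum r A"
  obtains w where "w \<in> open_pseudo r A" "path_component (pseudospectrum r A) z w"
proof (cases "z \<in> open_pseudo r A")
  case True
  with z show ?thesis by (intro that[of z]) (simp_all add: path_component_refl)
next
  case False
  define L where "L = pseudospectrum r A"
  have L: "x \<in> L \<longleftrightarrow> \<not> (\<exists>m>r. inv_below (pencil A x) m)" for x
    unfolding L_def using pseudospectrum_iff[OF A] r by simp
  have OL: "open_pseudo r A \<subseteq> L" unfolding L_def using open_pseudo_subset[OF A] r by simp
  have below: "inv_below (pencil A z) r" using False by (simp add: open_pseudo_def)
  then have zs: "z \<notin> spectrum A" using not_in_spectrum_iff[OF A] r by blast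
  have "\<exists>y v. norm v \<le> 1 \<and> norm y \<le> 1 \<and> 1 / (r + 1 / Suc n) \<le> cmod (cfun v (resolvent A z y))" for n
  proof -
    define s where "s = r + 1 / Suc n"
    have s: "s > r" "s > 0" using r by (simp_all add: s_def add_pos_pos)
    have "\<not> inv_below (pencil A z) s" using z s(1) L[of z] by (auto simp: L_def)
    then obtain u where u: "norm (pencil A z u) < s * norm u"
      using below by (auto simp: inv_below_def not_le)
    define N where "N = norm (pencil A z u)"
    have "u \<noteq> 0" using u by auto
    then have "0 < r * norm u" using r by simp
    also have "\<dots> \<le> N" using below by (simp add: N_def inv_below_def)
    finally have N: "N > 0" .
    \<comment> \<open>Scaled so that its image under the pencil is a unit vector; then
      \<open>norm u'\<close> is at least \<open>1 / s\<close>.\<close>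
    define u' where "u' = complex_of_real (1 / N) *\<^sub>C u"
    obtain v where v: "norm v \<le> 1" "norm u' \<le> cmod (cfun v u')" by (rule norming_cfun)
    have "norm (pencil A z u') \<le> 1"
      using N by (simp add: u'_def pencil_scaleC[OF A] norm_scaleC norm_divide flip: N_def)
    moreover have "1 / s \<le> norm u'"
      using u N s(2) by (simp add: u'_def norm_scaleC norm_divide field_simps flip: N_def)
    ultimately show ?thesis
      using v by (intro exI[of _ "pencil A z u'"] exI[of _ v])
        (auto simp: resolvent_pencil[OF A zs] s_def)
  qed
  then obtain Y V where YV: "\<And>n. norm (V n) \<le> 1" "\<And>n. norm (Y n) \<le> 1"
    "\<And>n. 1 / (r + 1 / Suc n) \<le> cmod (cfun (V n) (resolvent A z (Y n)))"
    by metis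
  obtain w where w: "w \<in> spectrum A" "\<And>x. x \<in> spectrum A \<Longrightarrow> dist z w \<le> dist z x"
    using distance_attains_inf[OF closed_spectrum[OF A] ne] by blast
  define B where "B = ball z (dist z w)"
  have B: "B \<subseteq> - spectrum A" "z \<in> B" "open B" "connected B"
    using w zs by (auto simp: B_def not_less[symmetric])
  define F where "F = (\<lambda>n x. cfun (V n) (resolvent A x (Y n)))"
  have F: "cmod (F n x) \<le> 1 / m" if "inv_below (pencil A x) m" "m > 0" for n x m
    using norm_cfun_resolvent_le[OF A that YV(1), of n "Y n"] YV(2)[of n] that(2)
      divide_right_mono[of "norm (Y n)" 1 m] by (simp add: F_def)
  obtain h q where hol: "h holomorphic_on B" and q: "strict_mono (q :: nat \<Rightarrow> nat)"
    and lim: "\<And>x. x \<in> B \<Longrightarrow> (\<lambda>n. F (q n) x) \<longlonglongrightarrow> h x"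
  proof (rule Montel[OF B(3), of "range F" F])
    show "f holomorphic_on B" if "f \<in> range F" for f
      using that holomorphic_on_subset[OF holomorphic_cfun_resolvent[OF A] B(1)]
      by (auto simp: F_def)
    show "\<exists>b. \<forall>f\<in>range F. \<forall>x\<in>K. cmod (f x) \<le> b" if K: "compact K" "K \<subseteq> B" for K
    proof -
      have "\<forall>x\<in>K. \<exists>m>0. inv_below (pencil A x) m"
        using K(2) B(1) not_in_spectrum_iff[OF A] by blast
      then obtain m where m: "\<And>x. x \<in> K \<Longrightarrow> m x > 0" "\<And>x. x \<in> K \<Longrightarrow> inv_below (pencil A x) (m x)"
        by metis
      obtain K' where K': "K' \<subseteq> K" "finite K'" "K \<subseteq> (\<Union>x\<in>K'. ball x (m x / 2))"
      proof (rule compactE_image[OF K(1), of K "\<lambda>x. ball x (m x / 2)"])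
        show "K \<subseteq> (\<Union>x\<in>K. ball x (m x / 2))" using m(1) by force
      qed auto
      \<comment> \<open>Montel requires one bound on all of \<open>K\<close>. Summing the bounds of
        the finite cover dominates each of them.\<close>
      have "cmod (F n x) \<le> (\<Sum>k\<in>K'. 1 / (m k / 2))" if x: "x \<in> K" for n x
      proof -
        obtain k where k: "k \<in> K'" "x \<in> ball k (m k / 2)" using K'(3) x by blast
        then have d: "cmod (x - k) < m k / 2" by (simp add: dist_norm norm_minus_commute)
        have mk: "m k > 0" "inv_below (pencil A k) (m k)" using k K'(1) m by auto
        have "inv_below (pencil A x) (m k - cmod (x - k))"
          using d mk(1) by (intro inv_below_pencil_shift[OF A mk(2)]) simp
        then have "inv_below (pencil A x) (m k / 2)"
          by (rule inv_below_mono) (use d in simp)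
        then have "cmod (F n x) \<le> 1 / (m k / 2)" by (rule F) (use mk in simp)
        also have "\<dots> \<le> (\<Sum>k\<in>K'. 1 / (m k / 2))"
          using K' k m(1) by (intro member_le_sum) (auto intro: less_imp_le)
        finally show ?thesis .
      qed
      then show ?thesis by blast
    qed
  qed auto
  have h_le: "cmod (h x) \<le> 1 / m" if "inv_below (pencil A x) m" "m > 0" "x \<in> B" for x m
    using tendsto_norm[OF lim[OF that(3)]] F[OF that(1,2)] by (intro LIMSEQ_le_const2) auto
  have in_L: "x \<in> L" if "x \<in> B" "1 / r \<le> cmod (h x)" for x
  proof (rule ccontr)
    assume "x \<notin> L"
    then obtain m where m: "m > r" "inv_below (pencil A x) m" using L by blast
    then have "cmod (h x) \<le> 1 / m" using r that(1) by (intro h_le) auto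
    also have "\<dots> < 1 / r" using m(1) r by (intro divide_strict_left_mono) auto
    finally show False using that(2) by simp
  qed
  have in_O: "x \<in> open_pseudo r A" if "x \<in> B" "1 / r < cmod (h x)" for x
    using h_le[of x r] that r by (auto simp: open_pseudo_def)
  have hz: "1 / r \<le> cmod (h z)"
  proof (rule LIMSEQ_le)
    show "(\<lambda>n. cmod (F (q n) z)) \<longlonglongrightarrow> cmod (h z)" by (intro tendsto_norm lim B(2))
    have "(\<lambda>n. 1 / (r + 1 / Suc n)) \<longlonglongrightarrow> 1 / (r + 0)"
      using r LIMSEQ_inverse_real_of_nat by (intro tendsto_intros) (auto simp: inverse_eq_divide)
    then show "(\<lambda>n. 1 / (r + 1 / Suc (q n))) \<longlonglongrightarrow> 1 / r"
      using LIMSEQ_subseq_LIMSEQ[OF _ q, of "\<lambda>n. 1 / (r + 1 / Suc n)"] by (simp add: o_def)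
    show "\<exists>N. \<forall>n\<ge>N. 1 / (r + 1 / Suc (q n)) \<le> cmod (F (q n) z)"
      using YV(3) by (auto simp: F_def)
  qed
  show thesis
  proof (cases "h constant_on B")
    case True
    then have h_const: "h x = h z" if "x \<in> B" for x using that B(2) by (auto simp: constant_on_def)
    have "closed_segment z w \<subseteq> L"
    proof
      fix x assume "x \<in> closed_segment z w"
      then obtain t where t: "0 \<le> t" "t \<le> 1" "x = z + t *\<^sub>R (w - z)"
        by (auto simp: in_segment algebra_simps)
      show "x \<in> L"
      proof (cases "t = 1")
        case True
        then show ?thesis using w(1) t(3) OL spectrum_subset_open_pseudo[OF A r] by auto
      next
        case False
        have "dist z x = t * dist z w" using t by (simp add: dist_norm norm_minus_commute)
        also have "\<dots> < 1 * dist z w"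
        proof (rule mult_strict_right_mono)
          show "0 < dist z w" using zs w(1) by auto
        qed (use False t in simp)
        finally have "x \<in> B" by (simp add: B_def)
        then show ?thesis using hz h_const by (intro in_L) simp_all
      qed
    qed
    then have "path_component L z w" by (rule path_component_linepath)
    moreover have "w \<in> open_pseudo r A" using w(1) spectrum_subset_open_pseudo[OF A r] by blast
    ultimately show thesis using that by (simp add: L_def)
  next
    case False
    have nonconst: "\<not> (\<lambda>x. h x - h z) constant_on B"
    proof
      assume "(\<lambda>x. h x - h z) constant_on B"
      then obtain c where "\<And>x. x \<in> B \<Longrightarrow> h x - h z = c" by (auto simp: constant_on_def)
      then have "\<forall>x\<in>B. h x = c + h z" by (simp add: diff_eq_eq)
      with False show False unfolding constant_on_def by blast
    qed
    have hol_diff: "(\<lambda>x. h x - h z) holomorphic_on B" by (intro holomorphic_intros hol)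
    obtain g \<rho> n where n: "0 < (n::nat)" and \<rho>: "0 < \<rho>" "ball z \<rho> \<subseteq> B"
      and g: "g holomorphic_on ball z \<rho>"
        "\<And>x. x \<in> ball z \<rho> \<Longrightarrow> h x - h z = (x - z) ^ n * g x" "\<And>x. x \<in> ball z \<rho> \<Longrightarrow> g x \<noteq> 0"
    proof (rule holomorphic_factor_zero_nonconstant[OF hol_diff B(3,4,2) _ nonconst])
      show "h z - h z = 0" by simp
    qed (rule that)
    have gz: "g z \<noteq> 0" using g(3) \<rho>(1) by simp
    have hz0: "h z \<noteq> 0"
    proof
      assume "h z = 0"
      then show False using hz r by simp
    qed
    \<comment> \<open>Near \<open>z\<close> the factor \<open>g x / g z\<close> is close to 1, so
      its real part stays positive.\<close>
    have "isCont g z"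
      using holomorphic_on_imp_continuous_on[OF g(1)] \<rho>(1)
      by (simp add: continuous_on_eq_continuous_at)
    then have "isCont (\<lambda>x. g x / g z) z" using gz by (intro continuous_intros)
    then obtain \<delta> where \<delta>: "\<delta> > 0" "\<And>x. dist x z < \<delta> \<Longrightarrow> dist (g x / g z) (g z / g z) < 1"
      unfolding continuous_at_eps_delta by (meson zero_less_one)
    have Re_pos: "Re (g x / g z) > 0" if "dist x z < \<delta>" for x
    proof -
      have "cmod (1 - g x / g z) < 1"
        using \<delta>(2)[OF that] unfolding dist_norm divide_self[OF gz] by (subst norm_minus_commute)
      then show ?thesis using complex_Re_le_cmod[of "1 - g x / g z"] by simp
    qed
    have "n \<noteq> 0" using n by simp
    \<comment> \<open>This root aligns the leading term with \<open>h z\<close>: in direction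
      \<open>\<omega>\<close> it is \<open>t ^ n * h z\<close>, so \<open>h x / h z\<close> is 1
      plus a number of positive real part, and the modulus grows.\<close>
    then obtain \<omega> where "h z / g z = \<omega> ^ n" by (rule exists_complex_root)
    note \<omega> = this[symmetric]
    have \<omega>0: "\<omega> \<noteq> 0"
    proof
      assume "\<omega> = 0"
      then have "h z / g z = 0" unfolding \<omega>[symmetric] using n by simp
      then show False using hz0 gz by simp
    qed
    define T where "T = min \<rho> \<delta> / (2 * cmod \<omega>)"
    have T: "T > 0" "T * cmod \<omega> < \<rho>" "T * cmod \<omega> < \<delta>"
    proof -
      show "T > 0" using \<rho>(1) \<delta>(1) \<omega>0 unfolding T_def by simp
      have "T * cmod \<omega> = min \<rho> \<delta> / 2" unfolding T_def using \<omega>0 by simp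
      then show "T * cmod \<omega> < \<rho>" "T * cmod \<omega> < \<delta>" using \<rho>(1) \<delta>(1) by linarith+
    qed
    have grow: "z + of_real t * \<omega> \<in> B \<and> cmod (h z) < cmod (h (z + of_real t * \<omega>))"
      if t: "0 < t" "t \<le> T" for t
    proof -
      define x where "x = z + of_real t * \<omega>"
      have "dist x z = t * cmod \<omega>" using t by (simp add: x_def dist_norm norm_mult)
      also have "\<dots> \<le> T * cmod \<omega>" using t by (intro mult_right_mono) auto
      finally have dx: "dist x z < \<rho>" "dist x z < \<delta>" using T by auto
      then have xb: "x \<in> ball z \<rho>" by (simp add: dist_commute)
      define \<tau> \<kappa> where "\<tau> = t ^ n" and "\<kappa> = g x / g z"
      have \<kappa>: "Re \<kappa> > 0" "g x = \<kappa> * g z" using Re_pos[OF dx(2)] gz by (simp_all add: \<kappa>_def)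
      have "\<omega> ^ n * g z = h z" using \<omega> gz by simp
      moreover have "h x - h z = (of_real t * \<omega>) ^ n * g x" using g(2)[OF xb] by (simp add: x_def)
      ultimately have "h x - h z = of_real \<tau> * \<kappa> * h z"
        unfolding \<kappa>(2) power_mult_distrib \<tau>_def of_real_power by (metis mult.commute mult.left_commute)
      then have "h x = h z * (1 + of_real \<tau> * \<kappa>)" by (simp add: algebra_simps)
      then have hx: "cmod (h x) = cmod (h z) * cmod (1 + of_real \<tau> * \<kappa>)" by (simp add: norm_mult)
      have "\<tau> > 0" using t by (simp add: \<tau>_def)
      then have "1 < 1 + \<tau> * Re \<kappa>" using \<kappa>(1) by simp
      also have "\<dots> = Re (1 + of_real \<tau> * \<kappa>)" by simp
      also have "\<dots> \<le> cmod (1 + of_real \<tau> * \<kappa>)" by (rule complex_Re_le_cmod)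
      finally have "cmod (h z) < cmod (h x)" unfolding hx using hz0 by simp
      then show ?thesis using xb \<rho>(2) by (auto simp: x_def)
    qed
    define w' where "w' = z + of_real T * \<omega>"
    have "closed_segment z w' \<subseteq> L"
    proof
      fix x assume "x \<in> closed_segment z w'"
      then obtain s where s: "0 \<le> s" "s \<le> 1" "x = z + of_real (s * T) * \<omega>"
        by (auto simp: in_segment w'_def scaleR_conv_of_real algebra_simps)
      show "x \<in> L"
      proof (cases "s = 0")
        case True
        then show ?thesis using s(3) z by (simp add: L_def)
      next
        case False
        then have "0 < s * T" "s * T \<le> T" using s T(1) by (auto simp: mult_left_le_one_le)
        from grow[OF this] show ?thesis using hz s(3) by (intro in_L) auto
      qed
    qed
    then have "path_component L z w'" by (rule path_component_linepath)
    moreover have "w' \<in> open_pseudo r A"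
      using grow[OF T(1) order_refl] hz by (intro in_O) (auto simp: w'_def)
    ultimately show thesis using that by (simp add: L_def)
  qed
qed

theorem path_connected_pseudospectrum_perturb:
  assumes A: "bounded_clinear A" and A0: "bounded_clinear A0"
    and close: "\<And>u. norm (A u - A0 u) \<le> e * norm u" and e: "0 \<le> e" "2 * e < r"
    and ne: "spectrum A0 \<noteq> {}" and pc: "path_connected (spectrum A0)"
  shows "path_connected (pseudospectrum r A)"
proof -
  have r: "r > 0" "r - e > 0" "e < r - e" using e by auto
  have close': "norm (A0 u - A u) \<le> e * norm u" for u
    using close[of u] by (simp add: norm_minus_commute)
  define L where "L = pseudospectrum r A"
  have sub0: "open_pseudo (r - e) A0 \<subseteq> L"
  proof
    fix x assume x: "x \<in> open_pseudo (r - e) A0"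
    have False if m: "m > r" "inv_below (pencil A x) m" for m
    proof -
      have "inv_below (pencil A0 x) (m - e)"
        using m e by (intro inv_below_pencil_perturb[OF A A0 close]) auto
      then have "inv_below (pencil A0 x) (r - e)" by (rule inv_below_mono) (use m in simp)
      with x show False by (simp add: open_pseudo_def)
    qed
    then show "x \<in> L" using pseudospectrum_iff[OF A] r(1) by (auto simp: L_def)
  qed
  have sub1: "spectrum A0 \<subseteq> open_pseudo r A"
  proof
    fix x assume x: "x \<in> spectrum A0"
    show "x \<in> open_pseudo r A"
    proof (rule ccontr)
      assume "x \<notin> open_pseudo r A"
      then have "inv_below (pencil A0 x) (r - e)"
        using r e by (intro inv_below_pencil_perturb[OF A A0 close]) (auto simp: open_pseudo_def)
      with x r(2) not_in_spectrum_iff[OF A0] show False by blast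
    qed
  qed
  have sub2: "spectrum A \<subseteq> open_pseudo (r - e) A0"
  proof
    fix x assume x: "x \<in> spectrum A"
    show "x \<in> open_pseudo (r - e) A0"
    proof (rule ccontr)
      assume "x \<notin> open_pseudo (r - e) A0"
      then have "inv_below (pencil A x) (r - e - e)"
        using r e by (intro inv_below_pencil_perturb[OF A0 A close']) (auto simp: open_pseudo_def)
      moreover have "r - e - e > 0" using e by simp
      ultimately show False using x not_in_spectrum_iff[OF A] by blast
    qed
  qed
  obtain w0 where w0: "w0 \<in> spectrum A0" using ne by blast
  \<comment> \<open>Inherited from \<open>A0\<close>: the component of \<open>w0\<close> in
    \<open>open_pseudo r A\<close> contains a spectral point of \<open>A\<close>.\<close>
  have neA: "spectrum A \<noteq> {}"
    using component_meets_spectrum[OF A r(1), of w0] w0 sub1 by blast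
  have to_w0: "path_component L z w0" if "z \<in> L" for z
  proof -
    obtain w1 where w1: "w1 \<in> open_pseudo r A" "path_component L z w1"
      using path_to_open_pseudo[OF A r(1) neA, of z] \<open>z \<in> L\<close> unfolding L_def by blast
    obtain w2 where w2: "w2 \<in> spectrum A" "path_component (open_pseudo r A) w1 w2"
      using component_meets_spectrum[OF A r(1) w1(1)] by blast
    obtain w3 where w3: "w3 \<in> spectrum A0" "path_component (open_pseudo (r - e) A0) w2 w3"
      using component_meets_spectrum[OF A0 r(2), of w2] w2(1) sub2 by blast
    have "path_component (spectrum A0) w3 w0"
      using pc w3(1) w0 by (simp add: path_connected_component)
    moreover have "spectrum A0 \<subseteq> L"
      using spectrum_subset_open_pseudo[OF A0 r(2)] sub0 by blast
    ultimately have "path_component L w3 w0" by (meson path_component_of_subset)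
    moreover have "path_component L w2 w3" using w3(2) sub0 by (meson path_component_of_subset)
    moreover have "path_component L w1 w2"
      using w2(2) open_pseudo_subset[OF A, of r] r(1) unfolding L_def
      by (meson less_imp_le path_component_of_subset)
    ultimately show ?thesis using w1(2) by (meson path_component_trans)
  qed
  then show ?thesis
    unfolding path_connected_component L_def[symmetric] by (meson path_component_sym path_component_trans)
qed

section \<open>Jacobi operators with constant coefficients\<close>

lemma ell2_norm_le_shift:
  assumes "\<And>n. cmod (coord v n) \<le> M * cmod (coord u (n + k))" and M: "0 \<le> M"
  shows "norm v \<le> M * norm u"
proof -
  have bij: "bij (\<lambda>n::int. n + k)"
    by (intro bij_betw_byWitness[where f' = "\<lambda>n. n - k"]) auto
  have "(norm v)\<^sup>2 \<le> (\<Sum>\<^sub>\<infinity>n. M\<^sup>2 * (cmod (coord u (n + k)))\<^sup>2)"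
    unfolding norm_ell2_power2
  proof (rule infsum_mono)
    show "(\<lambda>n. (cmod (coord v n))\<^sup>2) summable_on UNIV"
      using square_summable_coord[of v] by (simp add: square_summable_def)
    show "(\<lambda>n. M\<^sup>2 * (cmod (coord u (n + k)))\<^sup>2) summable_on UNIV"
      using square_summable_shift[OF square_summable_coord[of u], of k]
      by (intro summable_on_cmult_right) (simp add: square_summable_def)
    show "(cmod (coord v n))\<^sup>2 \<le> M\<^sup>2 * (cmod (coord u (n + k)))\<^sup>2" for n
      using power_mono[OF assms(1)[of n], of 2] by (simp add: power_mult_distrib)
  qed
  also have "\<dots> = M\<^sup>2 * (\<Sum>\<^sub>\<infinity>n. (cmod (coord u (n + k)))\<^sup>2)"
    by (rule infsum_cmult_right')
  also have "\<dots> = (M * norm u)\<^sup>2"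
    using infsum_reindex_bij_betw[OF bij, of "\<lambda>n. (cmod (coord u n))\<^sup>2"]
    by (simp add: norm_ell2_power2 power_mult_distrib)
  finally show ?thesis using M by (simp add: abs_le_square_iff[symmetric])
qed

text \<open>The difference splits into its three diagonals, each a weighted shift of norm at most
  the bound on its weights.\<close>

lemma norm_jacobi_diff_le:
  assumes per: "periodic p a" "periodic p b" "periodic p c" "p \<ge> 1"
    and bd: "\<And>n. \<bar>a n - \<alpha>\<bar> \<le> A" "\<And>n. \<bar>b n - \<beta>\<bar> \<le> B" "\<And>n. \<bar>c n - \<gamma>\<bar> \<le> C"
  shows "norm (jacobi a b c u - jacobi (\<lambda>_. \<alpha>) (\<lambda>_. \<beta>) (\<lambda>_. \<gamma>) u) \<le> (A + B + C) * norm u"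
proof -
  have const: "periodic p (\<lambda>_. x)" for x by (simp add: periodic_def)
  have diff: "periodic p (\<lambda>n. a n - \<alpha>)" "periodic p (\<lambda>n. b n - \<beta>)" "periodic p (\<lambda>n. c n - \<gamma>)"
    using per by (simp_all add: periodic_def)
  note cj = coord_jacobi[OF _ _ _ per(4)]
  define x y z where "x = jacobi (\<lambda>n. a n - \<alpha>) (\<lambda>_. 0) (\<lambda>_. 0) u"
    and "y = jacobi (\<lambda>_. 0) (\<lambda>n. b n - \<beta>) (\<lambda>_. 0) u"
    and "z = jacobi (\<lambda>_. 0) (\<lambda>_. 0) (\<lambda>n. c n - \<gamma>) u"
  note xyz = x_def y_def z_def
  have "jacobi a b c u - jacobi (\<lambda>_. \<alpha>) (\<lambda>_. \<beta>) (\<lambda>_. \<gamma>) u = x + y + z"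
    unfolding xyz
    by (rule ell2_eqI)
      (simp add: minus_ell2.rep_eq plus_ell2.rep_eq cj const diff per algebra_simps)
  also have "norm \<dots> \<le> norm x + norm y + norm z"
    by (intro norm_triangle_mono norm_triangle_ineq) simp
  also have "norm x \<le> A * norm u"
  proof (rule ell2_norm_le_shift)
    show "cmod (coord x n) \<le> A * cmod (coord u (n + 0))" for n
      unfolding xyz using mult_right_mono[OF bd(1)[of n], of "cmod (coord u n)"]
      by (simp add: cj const diff norm_mult flip: of_real_diff)
    show "0 \<le> A" using bd(1)[of 0] by linarith
  qed
  also have "norm y \<le> B * norm u"
  proof (rule ell2_norm_le_shift)
    show "cmod (coord y n) \<le> B * cmod (coord u (n + 1))" for n
      unfolding xyz using mult_right_mono[OF bd(2)[of n], of "cmod (coord u (n + 1))"]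
      by (simp add: cj const diff norm_mult flip: of_real_diff)
    show "0 \<le> B" using bd(2)[of 0] by linarith
  qed
  also have "norm z \<le> C * norm u"
  proof (rule ell2_norm_le_shift)
    show "cmod (coord z n) \<le> C * cmod (coord u (n + - 1))" for n
      unfolding xyz using mult_right_mono[OF bd(3)[of "n - 1"], of "cmod (coord u (n - 1))"]
      by (simp add: cj const diff norm_mult flip: of_real_diff)
    show "0 \<le> C" using bd(3)[of 0] by linarith
  qed
  finally show ?thesis by (simp add: algebra_simps)
qed

section \<open>Shifts and the spectrum for constant coefficients\<close>

lemma coord_jacobi_const:
  "coord (jacobi (\<lambda>_. \<alpha>) (\<lambda>_. \<beta>) (\<lambda>_. \<gamma>) u) n
    = of_real \<gamma> * coord u (n - 1) + of_real \<alpha> * coord u n + of_real \<beta> * coord u (n + 1)"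
  by (rule coord_jacobi[of 1]) (simp_all add: periodic_def)

lemma bounded_clinear_jacobi_const: "bounded_clinear (jacobi (\<lambda>_. \<alpha>) (\<lambda>_. \<beta>) (\<lambda>_. \<gamma>))"
  by (rule bounded_clinear_jacobi[of 1]) (simp_all add: periodic_def)

text \<open>Encoded as Jacobi operators so that coordinates and linearity come from the general
  lemmas.\<close>

definition lshift :: "ell2 \<Rightarrow> ell2" where "lshift = jacobi (\<lambda>_. 0) (\<lambda>_. 1) (\<lambda>_. 0)"
definition rshift :: "ell2 \<Rightarrow> ell2" where "rshift = jacobi (\<lambda>_. 0) (\<lambda>_. 0) (\<lambda>_. 1)"

lemma coord_shift:
  "coord (lshift u) n = coord u (n + 1)" "coord (rshift u) n = coord u (n - 1)"
  by (simp_all add: lshift_def rshift_def coord_jacobi_const)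

lemma norm_shift: "norm (lshift u) = norm u" "norm (rshift u) = norm u"
proof -
  have "norm (lshift u) \<le> 1 * norm u" "norm (rshift u) \<le> 1 * norm u" for u
    by (rule ell2_norm_le_shift[where k = 1] ell2_norm_le_shift[where k = "- 1"];
        simp add: coord_shift)+
  moreover have "lshift (rshift u) = u" "rshift (lshift u) = u" for u
    by (simp_all add: ell2_eqI coord_shift)
  ultimately show "norm (lshift u) = norm u" "norm (rshift u) = norm u"
    by (metis antisym mult_1)+
qed

lemma inv_below_shift: "inv_below lshift 1" "inv_below rshift 1"
proof -
  have "surj lshift" by (rule surjI[of _ rshift]) (simp add: ell2_eqI coord_shift)
  then show "inv_below lshift 1" by (simp add: inv_below_def norm_shift)
  have "surj rshift" by (rule surjI[of _ lshift]) (simp add: ell2_eqI coord_shift)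
  then show "inv_below rshift 1" by (simp add: inv_below_def norm_shift)
qed

text \<open>The shift is an isometry, so whichever of the two terms has the larger coefficient
  dominates and the other is a perturbation.\<close>

lemma inv_below_linear_factor:
  assumes "cmod s \<noteq> cmod t"
  obtains m where "m > 0" "inv_below (\<lambda>u. s *\<^sub>C lshift u + t *\<^sub>C u) m"
proof -
  have lin: "linear lshift"
    unfolding lshift_def by (intro bounded_clinear_linear bounded_clinear_jacobi_const)
  have lin_s: "linear (\<lambda>u. s *\<^sub>C lshift u)"
    using linear_compose[OF lin linear_scaleC[of s]] by (simp add: o_def)
  show thesis
  proof (cases "cmod s < cmod t")
    case True
    then have "t \<noteq> 0" by auto
    then have "inv_below (\<lambda>u. t *\<^sub>C u + s *\<^sub>C lshift u) (cmod t - cmod s)"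
      by (intro inv_below_perturb[OF linear_scaleC inv_below_scaleC lin_s])
        (use True in \<open>auto simp: norm_scaleC norm_shift\<close>)
    then show ?thesis using True that[of "cmod t - cmod s"] by (simp add: add.commute)
  next
    case False
    then have less: "cmod t < cmod s" using assms by simp
    then have "s \<noteq> 0" by auto
    then have "inv_below (\<lambda>u. s *\<^sub>C lshift u) (cmod s * 1)"
      by (intro inv_below_comp inv_below_scaleC inv_below_shift) simp_all
    then have "inv_below (\<lambda>u. s *\<^sub>C lshift u + t *\<^sub>C u) (cmod s * 1 - cmod t)"
      by (rule inv_below_perturb[OF lin_s _ linear_scaleC]) (use less in \<open>auto simp: norm_scaleC\<close>)
    then show ?thesis using less that[of "cmod s * 1 - cmod t"] by simp
  qed
qed

text \<open>Factors \<open>s * X + t\<close> instead of \<open>X - root\<close> allow a vanishing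
  leading coefficient, needed when \<open>\<beta> = 0\<close>.\<close>

lemma quadratic_splits:
  fixes b d c :: complex
  obtains s1 t1 s2 t2 where "s1 * s2 = b" "s1 * t2 + t1 * s2 = d" "t1 * t2 = c"
proof (cases "b = 0")
  case True
  \<comment> \<open>Here and below, \<open>of\<close> fills \<open>s1\<close>, \<open>s2\<close>,
    \<open>t2\<close>, \<open>t1\<close> in this order.\<close>
  then show ?thesis by (intro that[of d 0 1 c]) auto
next
  case False
  define D where "D = csqrt (d\<^sup>2 - 4 * b * c)"
  have D: "D * D = d * d - 4 * b * c"
    unfolding D_def by (metis power2_csqrt power2_eq_square)
  show ?thesis
  proof (rule that[of b 1 "(d - D) / (2 * b)" "(d + D) / 2"])
    show "(d + D) / 2 * ((d - D) / (2 * b)) = c"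
      using False D by (simp add: field_simps)
    show "b * ((d - D) / (2 * b)) + (d + D) / 2 * 1 = d"
      using False by (simp add: field_simps)
  qed simp
qed

text \<open>Tested on the plane wave $\zeta^n$ cut off to \<open>N\<close> consecutive sites.\<close>

lemma shift_not_bounded_below:
  assumes \<zeta>: "cmod \<zeta> = 1" and m: "m > 0"
  obtains u where "norm (lshift u - \<zeta> *\<^sub>C u) < m * norm u"
proof -
  obtain N0 :: nat where N0: "2 / m\<^sup>2 < real N0" using reals_Archimedean2 by blast
  define N where "N = Suc N0"
  have N: "2 < m\<^sup>2 * real N"
    using N0 m by (simp add: N_def field_simps) (smt (verit) zero_less_power)
  define f where "f n = (if n \<in> {0..<int N} then \<zeta> ^ nat n else 0)" for n
  have "(\<lambda>n. (cmod (f n))\<^sup>2) summable_on {0..<int N}" by simp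
  then have "square_summable f"
    unfolding square_summable_def by (rule summable_on_cong_neutral[THEN iffD1, rotated -1]) (auto simp: f_def)
  then obtain u where u: "coord u = f" by (metis Abs_ell2_inverse mem_Collect_eq)
  have "(norm u)\<^sup>2 = (\<Sum>\<^sub>\<infinity>n\<in>{0..<int N}. 1)"
    unfolding norm_ell2_power2 u by (rule infsum_cong_neutral) (auto simp: f_def norm_power \<zeta>)
  then have norm_u: "(norm u)\<^sup>2 = real N" by simp
  have z: "f (n + 1) - \<zeta> * f n = 0" if n: "n \<notin> {- 1, int N - 1}" for n
  proof (cases "0 \<le> n \<and> n < int N - 1")
    case True
    then have "nat (n + 1) = Suc (nat n)" by linarith
    with True show ?thesis by (simp add: f_def)
  next
    case False
    with n show ?thesis by (auto simp: f_def)
  qed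
  have "(norm (lshift u - \<zeta> *\<^sub>C u))\<^sup>2 = (\<Sum>\<^sub>\<infinity>n\<in>{- 1, int N - 1}. (cmod (f (n + 1) - \<zeta> * f n))\<^sup>2)"
    unfolding norm_ell2_power2 minus_ell2.rep_eq scaleC.rep_eq coord_shift u
    by (rule infsum_cong_neutral) (use z in auto)
  also have "\<dots> = 2"
    by (simp add: f_def N_def norm_mult norm_power \<zeta>)
  also have "\<dots> < (m * norm u)\<^sup>2" using N by (simp add: power_mult_distrib norm_u)
  finally have "norm (lshift u - \<zeta> *\<^sub>C u) < m * norm u"
    by (rule power2_less_imp_less) (use m in simp)
  then show thesis by (rule that)
qed

text \<open>The image is that of the symbol, the factor by which the operator acts on the wave with
  ratio \<open>\<zeta>\<close>. For \<open>w\<close> off it, \<open>\<zeta>\<close> times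
  (\<open>w\<close> minus symbol) is a quadratic without roots on the circle; for \<open>w\<close>
  on it, cut-off waves are approximate eigenvectors.\<close>

lemma spectrum_jacobi_const:
  fixes \<alpha> \<beta> \<gamma> :: real
  shows "spectrum (jacobi (\<lambda>_. \<alpha>) (\<lambda>_. \<beta>) (\<lambda>_. \<gamma>))
    = (\<lambda>\<zeta>. of_real \<alpha> + of_real \<beta> * \<zeta> + of_real \<gamma> * cnj \<zeta>) ` sphere 0 1"
    (is "spectrum ?J = ?f ` _")
proof (intro equalityI subsetI)
  note J = bounded_clinear_jacobi_const[of \<alpha> \<beta> \<gamma>]
  fix w assume w: "w \<in> spectrum ?J"
  show "w \<in> ?f ` sphere 0 1"
  proof (rule ccontr)
    assume notin: "w \<notin> ?f ` sphere 0 1"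
    obtain s1 t1 s2 t2 where st: "s1 * s2 = - of_real \<beta>" "s1 * t2 + t1 * s2 = w - of_real \<alpha>"
      "t1 * t2 = - of_real \<gamma>"
      by (rule quadratic_splits)
    have no_root: "(s1 * \<zeta> + t1) * (s2 * \<zeta> + t2) \<noteq> 0" if \<zeta>: "cmod \<zeta> = 1" for \<zeta>
    proof
      assume "(s1 * \<zeta> + t1) * (s2 * \<zeta> + t2) = 0"
      then have "s1 * s2 * \<zeta> * \<zeta> + (s1 * t2 + t1 * s2) * \<zeta> + t1 * t2 = 0"
        by (simp add: algebra_simps)
      then have "cnj \<zeta> * (w * \<zeta>) = cnj \<zeta> * (of_real \<beta> * \<zeta> * \<zeta> + of_real \<alpha> * \<zeta> + of_real \<gamma>)"
        unfolding st by (simp add: algebra_simps)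
      moreover have "cnj \<zeta> * \<zeta> = 1" using \<zeta> by (simp add: complex_norm_square[symmetric] mult.commute)
      ultimately have "w = ?f \<zeta>" by algebra
      with notin \<zeta> show False by auto
    qed
    \<comment> \<open>For equal nonzero moduli, \<open>- t / s\<close> would be a root on the
      circle.\<close>
    have ne: "cmod s \<noteq> cmod t"
      if nr: "\<And>\<zeta>. cmod \<zeta> = 1 \<Longrightarrow> s * \<zeta> + t \<noteq> 0" for s t
    proof
      assume eq: "cmod s = cmod t"
      show False
      proof (cases "s = 0")
        case True
        then show False using nr[of 1] eq by simp
      next
        case False
        then have "cmod (- t / s) = 1" by (simp add: norm_divide flip: eq)
        then show False using nr[of "- t / s"] False by simp
      qed
    qed
    obtain m1 where m1: "m1 > 0" "inv_below (\<lambda>u. s1 *\<^sub>C lshift u + t1 *\<^sub>C u) m1"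
      using inv_below_linear_factor[OF ne[of s1 t1]] no_root by auto
    obtain m2 where m2: "m2 > 0" "inv_below (\<lambda>u. s2 *\<^sub>C lshift u + t2 *\<^sub>C u) m2"
      using inv_below_linear_factor[OF ne[of s2 t2]] no_root by auto
    \<comment> \<open>\<open>wI - J\<close> is the inverse shift times a quadratic in the shift, which splits into linear factors.\<close>
    define P where "P u = rshift (s1 *\<^sub>C lshift (s2 *\<^sub>C lshift u + t2 *\<^sub>C u)
        + t1 *\<^sub>C (s2 *\<^sub>C lshift u + t2 *\<^sub>C u))" for u
    have "inv_below P (1 * (m1 * m2))"
      unfolding P_def
      by (intro inv_below_comp[OF inv_below_shift(2)] inv_below_comp[OF m1(2) m2(2)]) (use m1 in auto)
    moreover have "P = pencil ?J w"
    proof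
      fix u show "P u = pencil ?J w u"
      proof (rule ell2_eqI)
        fix n
        have "coord (P u) n = s1 * s2 * coord u (n + 1) + (s1 * t2 + t1 * s2) * coord u n
            + t1 * t2 * coord u (n - 1)"
          by (simp add: P_def coord_shift plus_ell2.rep_eq scaleC.rep_eq algebra_simps)
        also have "\<dots> = coord (pencil ?J w u) n"
          unfolding st by (simp add: pencil_def minus_ell2.rep_eq scaleC.rep_eq coord_jacobi_const
              algebra_simps)
        finally show "coord (P u) n = coord (pencil ?J w u) n" .
      qed
    qed
    moreover have "1 * (m1 * m2) > 0" using m1 m2 by simp
    ultimately show False using w not_in_spectrum_iff[OF J, of w] by metis
  qed
next
  note J = bounded_clinear_jacobi_const[of \<alpha> \<beta> \<gamma>]
  fix w assume "w \<in> ?f ` sphere 0 1"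
  then obtain \<zeta> where \<zeta>: "cmod \<zeta> = 1" "w = ?f \<zeta>" by auto
  have unit: "cnj \<zeta> * \<zeta> = 1" using \<zeta>(1) by (simp add: complex_norm_square[symmetric] mult.commute)
  show "w \<in> spectrum ?J"
  proof (rule ccontr)
    assume "w \<notin> spectrum ?J"
    then obtain m where m: "m > 0" "inv_below (pencil ?J w) m"
      using not_in_spectrum_iff[OF J] by blast
    \<comment> \<open>The \<open>+ 1\<close> keeps \<open>K\<close> positive when
      \<open>\<beta>\<close> and \<open>\<gamma>\<close> both vanish.\<close>
    define K where "K = \<bar>\<beta>\<bar> + \<bar>\<gamma>\<bar> + 1"
    have K: "K > 0" by (simp add: K_def)
    obtain u where u: "norm (lshift u - \<zeta> *\<^sub>C u) < m / K * norm u"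
      using shift_not_bounded_below[OF \<zeta>(1), of "m / K"] m(1) K by auto
    define v where "v = lshift u - \<zeta> *\<^sub>C u"
    \<comment> \<open>Both off-diagonal terms factor through \<open>v\<close>, because
      \<open>cnj \<zeta>\<close> inverts \<open>\<zeta>\<close>; so a small \<open>v\<close> makes
      the image small.\<close>
    have "pencil ?J w u = (of_real \<gamma> * cnj \<zeta>) *\<^sub>C rshift v - of_real \<beta> *\<^sub>C v"
    proof (rule ell2_eqI)
      fix n
      have "of_real \<gamma> * cnj \<zeta> * (\<zeta> * coord u (n - 1)) = of_real \<gamma> * coord u (n - 1)"
        using unit by (metis mult.assoc mult.left_neutral)
      then show "coord (pencil ?J w u) n
          = coord ((of_real \<gamma> * cnj \<zeta>) *\<^sub>C rshift v - of_real \<beta> *\<^sub>C v) n"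
        by (simp add: v_def \<zeta>(2) pencil_def minus_ell2.rep_eq scaleC.rep_eq coord_jacobi_const
            coord_shift algebra_simps)
    qed
    then have "norm (pencil ?J w u) \<le> norm ((of_real \<gamma> * cnj \<zeta>) *\<^sub>C rshift v) + norm (of_real \<beta> *\<^sub>C v)"
      by (metis norm_triangle_ineq4)
    also have "\<dots> = (\<bar>\<beta>\<bar> + \<bar>\<gamma>\<bar>) * norm v"
      by (simp add: norm_scaleC norm_mult norm_shift \<zeta>(1) algebra_simps)
    also have "\<dots> \<le> K * norm v" by (simp add: K_def mult_right_mono)
    also have "\<dots> < m * norm u" using u K by (simp add: v_def field_simps)
    finally show False using m(2) by (simp add: inv_below_def not_le[symmetric])
  qed
qed

lemma path_connected_spectrum_jacobi_const:
  "path_connected (spectrum (jacobi (\<lambda>_. \<alpha>) (\<lambda>_. \<beta>) (\<lambda>_. \<gamma>)))"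
  unfolding spectrum_jacobi_const
  by (intro path_connected_continuous_image continuous_intros path_connected_sphere) simp

lemma spectrum_jacobi_const_nonempty: "spectrum (jacobi (\<lambda>_. \<alpha>) (\<lambda>_. \<beta>) (\<lambda>_. \<gamma>)) \<noteq> {}"
  unfolding spectrum_jacobi_const by simp

text \<open>\<open>osc\<close> ranges over nonnegative indices only; reduction modulo
  \<open>p\<close> covers the negative ones.\<close>

lemma osc_ge:
  assumes "periodic p a" "p \<ge> 1"
  shows "\<bar>a n - a 0\<bar> \<le> osc a"
proof -
  have "a n = a (int (nat (n mod int p)))" using periodic_mod[OF assms(1), of n] assms(2) by simp
  then show ?thesis
    unfolding osc_def by (intro Max_ge finite_osc[OF assms]) (metis (mono_tags, lifting) mem_Collect_eq)
qed

lemma periodic_2_midpoint: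
  assumes a: "periodic 2 a"
  shows "\<bar>a n - (a 0 + a 1) / 2\<bar> \<le> osc a / 2"
proof -
  have "n mod 2 = 0 \<or> n mod 2 = 1" by auto
  then have "a n = a 0 \<or> a n = a 1" using periodic_mod[OF a, of n] by auto
  moreover have "\<bar>a 1 - a 0\<bar> \<le> osc a" by (rule osc_ge[OF a]) simp
  ultimately show ?thesis by (auto simp: abs_if field_simps split: if_splits)
qed

section \<open>Periodic Jacobi operators\<close>

theorem theorem3p6:
  fixes p :: nat and a b c :: "int \<Rightarrow> real" and k :: real
  assumes "p \<ge> 1"
    and "periodic p a" and "periodic p b" and "periodic p c"
    and "\<forall>i\<in>{0..int p - 1}. b i - c i = k"
  shows "path_connected
    (pseudospectrum (3 * sqrt ((real p - 1) * ((osc a)\<^sup>2 + 2 * (osc b)\<^sup>2))) (jacobi a b c))"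
proof -
  note p = assms(1) and per = assms(2-4)
  define wa wb where "wa = osc a" and "wb = osc b"
  define r where "r = 3 * sqrt ((real p - 1) * (wa\<^sup>2 + 2 * wb\<^sup>2))"
  have osc: "\<bar>a n - a 0\<bar> \<le> wa" "\<bar>b n - b 0\<bar> \<le> wb" for n
    unfolding wa_def wb_def using osc_ge per p by blast+
  then have w0: "0 \<le> wa" "0 \<le> wb" by (metis abs_ge_zero order_trans)+
  have c: "c n = b n - k" for n
    using periodic_mod[OF per(2), of n] periodic_mod[OF per(3), of n]
      bspec[OF assms(5), of "n mod int p"] p by simp
  have main: "path_connected (pseudospectrum r (jacobi a b c))"
    if "\<And>n. \<bar>a n - \<alpha>\<bar> \<le> A" "\<And>n. \<bar>b n - \<beta>\<bar> \<le> B" "2 * (A + 2 * B) < r" for \<alpha> \<beta> A B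
  proof (rule path_connected_pseudospectrum_perturb[OF bounded_clinear_jacobi[OF per p]
        bounded_clinear_jacobi_const _ _ that(3) spectrum_jacobi_const_nonempty
        path_connected_spectrum_jacobi_const])
    show "0 \<le> A + 2 * B" using that(1)[of 0] that(2)[of 0] by linarith
    show "norm (jacobi a b c u - jacobi (\<lambda>_. \<alpha>) (\<lambda>_. \<beta>) (\<lambda>_. \<beta> - k) u) \<le> (A + 2 * B) * norm u" for u
      using norm_jacobi_diff_le[OF per p that(1,2), where \<gamma> = "\<beta> - k" and C = B and u = u] that(2)
      by (simp add: c algebra_simps)
  qed
  \<comment> \<open>Comparing with the coefficients at \<open>0\<close> has error at most \<open>wa + 2 * wb\<close>, which by \<open>cs\<close> is less
    than \<open>r / 2\<close> only for \<open>p \<ge> 3\<close>; for \<open>p = 2\<close> the mean coefficients halve the error.\<close>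
  have cs: "(wa + 2 * wb)\<^sup>2 \<le> 3 * (wa\<^sup>2 + 2 * wb\<^sup>2)"
    using zero_le_power2[of "wa - wb"] by (simp add: power2_eq_square algebra_simps)
  have less_r: "t < r" if "t\<^sup>2 < 9 * ((real p - 1) * (wa\<^sup>2 + 2 * wb\<^sup>2))" for t
  proof -
    have "r\<^sup>2 = 9 * ((real p - 1) * (wa\<^sup>2 + 2 * wb\<^sup>2))"
      using p by (simp add: r_def power_mult_distrib)
    with that show ?thesis
      using p by (intro power2_less_imp_less[of t r]) (simp_all add: r_def)
  qed
  consider "p = 1 \<or> wa = 0 \<and> wb = 0" | "p = 2" "wa\<^sup>2 + 2 * wb\<^sup>2 > 0"
    | "p \<ge> 3" "wa\<^sup>2 + 2 * wb\<^sup>2 > 0"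
  proof -
    have "wa\<^sup>2 + 2 * wb\<^sup>2 > 0" if "\<not> (wa = 0 \<and> wb = 0)"
      using that by (simp add: add_nonneg_pos add_pos_nonneg less_le[of 0] add_nonneg_eq_0_iff)
    moreover have "p = 1 \<or> p = 2 \<or> p \<ge> 3" using p by auto
    ultimately show thesis using that by blast
  qed
  then have "path_connected (pseudospectrum r (jacobi a b c))"
  proof cases
    case 1
    \<comment> \<open>The perturbation theorem needs \<open>r > 0\<close>, but here the operator
      itself has constant coefficients.\<close>
    then have "r = 0" by (auto simp: r_def)
    have const: "a n = a 0 \<and> b n = b 0" for n
    proof (cases "p = 1")
      case True
      then show ?thesis using periodic_mod[OF per(1), of n] periodic_mod[OF per(2), of n] by simp
    next
      case False
      with 1 show ?thesis using osc[of n] by simp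
    qed
    then have "a = (\<lambda>_. a 0)" "b = (\<lambda>_. b 0)" "c = (\<lambda>_. b 0 - k)" by (auto simp: fun_eq_iff c)
    then have "jacobi a b c = jacobi (\<lambda>_. a 0) (\<lambda>_. b 0) (\<lambda>_. b 0 - k)" by metis
    then show ?thesis
      using path_connected_spectrum_jacobi_const \<open>r = 0\<close> by (simp add: pseudospectrum_0)
  next
    case 2
    have per2: "periodic 2 a" "periodic 2 b" using per 2 by auto
    \<comment> \<open>Twice the error is now \<open>wa + 2 * wb\<close>, and the factor 3 in
      \<open>cs\<close> is less than the 9 in the square of \<open>r\<close>.\<close>
    show ?thesis
      by (rule main[where A = "wa / 2" and B = "wb / 2"])
        (use periodic_2_midpoint[OF per2(1)] periodic_2_midpoint[OF per2(2)] less_r[of "wa + 2 * wb"] cs 2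
          in \<open>auto simp: wa_def wb_def\<close>)
  next
    case 3
    \<comment> \<open>The margin is 12 against 9 * 2, since \<open>p - 1\<close> is at least
      2.\<close>
    have "(2 * (wa + 2 * wb))\<^sup>2 \<le> 12 * (wa\<^sup>2 + 2 * wb\<^sup>2)"
      using cs unfolding power_mult_distrib by simp
    also have "\<dots> < 9 * (2 * (wa\<^sup>2 + 2 * wb\<^sup>2))" using 3 by simp
    also have "\<dots> \<le> 9 * ((real p - 1) * (wa\<^sup>2 + 2 * wb\<^sup>2))"
      using 3 by (intro mult_left_mono mult_right_mono) auto
    finally show ?thesis by (intro main[OF osc] less_r)
  qed
  then show ?thesis by (simp add: r_def wa_def wb_def)
qed

end
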